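(* Let $\lambda \vdash k$, let $n = l(\lambda)$, and let $H$ be a graph that does not contain $K_{n+1}^-$ as a subgraph. Let $m$ be the number of subgraphs of $H$ that are isomorphic to $K_n$. Then $$X_{K_\lambda}^H = m \cdot n!\, m_\lambda^{|V(H)|} = m \cdot n! \left(\prod_{j = 1}^{k} r_j(\lambda)!\right) \left(|V(H)| - \sum_{j=1}^k r_j(\lambda)\right)!\, m_\lambda .$$
   Context: All graphs are finite, simple, undirected, with at least one vertex; subgraphs are not required to be induced. For a partition $\lambda=(\lambda_1,\dots,\lambda_l)$, $l(\lambda)=l$ is its number of parts, $r_i(\lambda)$ the number of parts equal to $i$, and $m_\lambda$ the monomial symmetric function. $K_\lambda$ is the complete $l(\lambda)$-partite graph whose parts have $\lambda_1,\dots,\lambda_l$ vertices. $K_n$ is the complete graph on $n$ vertices and $K_n^-$ is $K_n$ with one edge deleted. $H$-chromatic symmetric function: let $G,H$ be graphs with $|V(G)|=k$, $|V(H)|=N$. A labeling of $H$ is a bijection $\phi:V(H)\to[N]$. A proper $(H,\phi)$-coloring of $G$ is a map $\kappa:V(G)\to[N]$ such that whenever $u,v$ are adjacent in $G$, $\phi^{-1}(\kappa(u))$ and $\phi^{-1}(\kappa(v))$ are adjacent in $H$. Put $w_G^H=\sum_\phi\sum_\kappa\prod_{v\in V(G)}x_{\kappa(v)}$, summed over all labelings $\phi$ and all proper $(H,\phi)$-colorings $\kappa$. This is a symmetric polynomial in $x_1,\dots,x_N$, homogeneous of degree $k$; writing $w_G^H=\sum_{\lambda\vdash k,\,l(\lambda)\le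 N}c_\lambda m_\lambda(x_1,\dots,x_N)$, define $X_G^H=\sum_{\lambda\vdash k,\,l(\lambda)\le N}c_\lambda m_\lambda\in\Lambda^k$ (so $X_G^H=0$ if there are no proper colorings). For $\lambda\vdash k$ with $l(\lambda)\le N$, the $N$-augmented monomial is $m_\lambda^N=\left(\prod_{i=1}^k r_i(\lambda)!\right)(N-l(\lambda))!\,m_\lambda$. Convention: if $l(\lambda)>|V(H)|$ (in which case $m=0$), the expressions on the right are read as $0$. *)

theory Defs
  imports
    "HOL-Library.Poly_Mapping"
    "HOL-Library.FuncSet"
    "HOL-Combinatorics.Permutations"
    "Graph_Theory.Pair_Digraph"
    "Graph_Theory.Digraph_Isomorphism"
begin

section \<open>Graphs\<close>

text \<open>
  Undirected edges are pairs of opposite arcs: \<^const>\<open>pair_graph\<close> says that the vertex set is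
  finite and the arc relation is symmetric and irreflexive on it. So \<open>u\<close> and \<open>v\<close> are adjacent
  in \<open>G\<close> iff \<open>(u, v) \<in> parcs G\<close>.
\<close>

definition simple_graph :: "'v pair_pre_digraph \<Rightarrow> bool" where
  "simple_graph G \<longleftrightarrow> pair_graph G \<and> pverts G \<noteq> {}"

text \<open>
  \<open>simple_graph S\<close> is needed below because \<^const>\<open>subgraph\<close> also admits subdigraphs that contain
  only one of two opposite arcs.
\<close>

definition copies :: "'w pair_pre_digraph \<Rightarrow> 'v pair_pre_digraph \<Rightarrow> 'v pair_pre_digraph set" where
  "copies F H = {S. simple_graph S \<and> subgraph (with_proj S) (with_proj H)
                   \<and> digraph_iso (with_proj S) (with_proj F)}"

definition contains_subgraph :: "'v pair_pre_digraph \<Rightarrow> 'w pair_pre_digraph \<Rightarrow> bool" where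
  "contains_subgraph H F \<longleftrightarrow> copies F H \<noteq> {}"

definition complete_graph :: "nat \<Rightarrow> nat pair_pre_digraph" where
  "complete_graph n = \<lparr> pverts = {..<n}, parcs = {(i, j). i < n \<and> j < n \<and> i \<noteq> j} \<rparr>"

text \<open>Meaningful for \<open>n \<ge> 2\<close>; the deleted edge is the one joining 0 and 1.\<close>

definition complete_graph_minus :: "nat \<Rightarrow> nat pair_pre_digraph" where
  "complete_graph_minus n =
     \<lparr> pverts = {..<n}, parcs = parcs (complete_graph n) - {(0, 1), (1, 0)} \<rparr>"

text \<open>The vertex \<open>(i, j)\<close> is the \<open>j\<close>-th vertex of the \<open>i\<close>-th part.\<close>

definition complete_multipartite :: "nat list \<Rightarrow> (nat \<times> nat) pair_pre_digraph" where
  "complete_multipartite \<nu> =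
     \<lparr> pverts = {(i, j). i < length \<nu> \<and> j < \<nu> ! i},
       parcs = {((i, j), (i', j')). i < length \<nu> \<and> j < \<nu> ! i \<and> i' < length \<nu> \<and> j' < \<nu> ! i'
                                    \<and> i \<noteq> i'} \<rparr>"


section \<open>Partitions\<close>

definition is_partition :: "nat list \<Rightarrow> nat \<Rightarrow> bool" (infix \<open>\<turnstile>p\<close> 50) where
  "\<nu> \<turnstile>p k \<longleftrightarrow> sorted_wrt (\<ge>) \<nu> \<and> 0 \<notin> set \<nu> \<and> sum_list \<nu> = k"

definition partitions_le :: "nat \<Rightarrow> nat \<Rightarrow> nat list set" where
  "partitions_le k N = {\<nu>. \<nu> \<turnstile>p k \<and> length \<nu> \<le> N}"

lemma complete_multipartite_graph:
  assumes "\<nu> \<turnstile>p k" "k \<ge> 1"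
  shows "simple_graph (complete_multipartite \<nu>)" "card (pverts (complete_multipartite \<nu>)) = k"
proof -
  let ?G = "complete_multipartite \<nu>"
  have V: "pverts ?G = (SIGMA i:{..<length \<nu>}. {..<\<nu> ! i})"
    by (auto simp: complete_multipartite_def)
  have fin: "finite (pverts ?G)" unfolding V by auto
  have sub: "parcs ?G \<subseteq> pverts ?G \<times> pverts ?G"
    by (auto simp: complete_multipartite_def)
  have finA: "finite (parcs ?G)"
    using finite_subset[OF sub] fin by blast
  have sym: "symmetric (with_proj ?G)"
    by (auto simp: symmetric_def complete_multipartite_def intro!: symI)
  have loopfree: "fst e \<noteq> snd e" if "e \<in> parcs ?G" for e
    using that by (auto simp: complete_multipartite_def)
  have "pair_graph ?G"
    using fin finA sym sub loopfree by unfold_locales auto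
  moreover show card: "card (pverts ?G) = k"
    using assms by (simp add: V is_partition_def sum_list_sum_nth atLeast0LessThan)
  ultimately show "simple_graph ?G"
    using assms(2) by (auto simp: simple_graph_def)
qed

lemma finite_partitions_le: "finite (partitions_le k N)"
proof (rule finite_subset)
  show "partitions_le k N \<subseteq> {\<nu>. set \<nu> \<subseteq> {..k} \<and> length \<nu> \<le> N}"
    by (auto simp: partitions_le_def is_partition_def member_le_sum_list)
qed (simp add: finite_lists_length_le)

lemma partition_eqI:
  assumes "\<nu> \<turnstile>p k" "\<mu> \<turnstile>p l" "mset \<nu> = mset \<mu>"
  shows "\<nu> = \<mu>"
proof -
  have "sorted (rev \<nu>)" "sorted (rev \<mu>)" "mset (rev \<nu>) = mset (rev \<mu>)"
    using assms by (auto simp: is_partition_def sorted_wrt_rev)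
  then have "rev \<nu> = rev \<mu>"
    by (metis properties_for_sort)
  then show ?thesis by simp
qed


section \<open>Symmetric functions\<close>

text \<open>
  A monomial is its exponent vector \<open>\<alpha> :: nat \<Rightarrow>\<^sub>0 nat\<close>; index \<open>i\<close> stands for the variable
  \<open>x\<^bsub>i+1\<^esub>\<close>, so the variables \<open>x\<^sub>1, \<dots>, x\<^sub>N\<close> and the colours \<open>[N]\<close> are indexed by \<open>{..<N}\<close>.
\<close>

definition monom_degree :: "(nat \<Rightarrow>\<^sub>0 nat) \<Rightarrow> nat" where
  "monom_degree \<alpha> = (\<Sum>i\<in>Poly_Mapping.keys \<alpha>. Poly_Mapping.lookup \<alpha> i)"

definition exp_mset :: "(nat \<Rightarrow>\<^sub>0 nat) \<Rightarrow> nat multiset" where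
  "exp_mset \<alpha> = image_mset (Poly_Mapping.lookup \<alpha>) (mset_set (Poly_Mapping.keys \<alpha>))"

lemma sum_mset_exp_mset: "sum_mset (exp_mset \<alpha>) = monom_degree \<alpha>"
  by (simp add: exp_mset_def monom_degree_def sum_unfold_sum_mset)

lemma exp_mset_map_key:
  assumes "bij \<pi>"
  shows "exp_mset (Poly_Mapping.map_key \<pi> \<alpha>) = exp_mset \<alpha>"
proof -
  have inj: "inj \<pi>" and surj: "surj \<pi>" using assms by (auto simp: bij_def)
  have l: "Poly_Mapping.lookup (Poly_Mapping.map_key \<pi> \<alpha>) = Poly_Mapping.lookup \<alpha> \<circ> \<pi>"
    using inj by (simp add: map_key.rep_eq)
  have k: "Poly_Mapping.keys \<alpha> = \<pi> ` Poly_Mapping.keys (Poly_Mapping.map_key \<pi> \<alpha>)"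
    using inj surj by (auto simp: keys_map_key)
  have "mset_set (Poly_Mapping.keys \<alpha>)
      = image_mset \<pi> (mset_set (Poly_Mapping.keys (Poly_Mapping.map_key \<pi> \<alpha>)))"
    unfolding k by (rule image_mset_mset_set[symmetric]) (use inj in \<open>auto intro: inj_on_subset\<close>)
  then show ?thesis
    by (simp add: exp_mset_def l multiset.map_comp)
qed

text \<open>
  The ring of symmetric functions: formal power series of bounded degree in countably many
  variables, given by their coefficients, invariant under permutations of the variables.
\<close>

typedef (overloaded) 'a symfun =
  "{f :: (nat \<Rightarrow>\<^sub>0 nat) \<Rightarrow> 'a :: zero.
      (\<exists>d. \<forall>\<alpha>. f \<alpha> \<noteq> 0 \<longrightarrow> monom_degree \<alpha> \<le> d) \<and>
      (\<forall>\<pi> \<alpha>. bij \<pi> \<longrightarrow> f (Poly_Mapping.map_key \<pi> \<alpha>) = f \<alpha>)}"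
  morphisms symfun_coeff Abs_symfun
  by (rule exI[of _ "\<lambda>_. 0"]) simp

setup_lifting type_definition_symfun

instantiation symfun :: (ab_group_add) ab_group_add
begin

lift_definition zero_symfun :: "'a symfun" is "\<lambda>_. 0" by simp

lift_definition plus_symfun :: "'a symfun \<Rightarrow> 'a symfun \<Rightarrow> 'a symfun" is "\<lambda>f g \<alpha>. f \<alpha> + g \<alpha>"
proof -
  fix f g :: "(nat \<Rightarrow>\<^sub>0 nat) \<Rightarrow> 'a"
  assume f: "(\<exists>d. \<forall>\<alpha>. f \<alpha> \<noteq> 0 \<longrightarrow> monom_degree \<alpha> \<le> d) \<and>
      (\<forall>\<pi> \<alpha>. bij \<pi> \<longrightarrow> f (Poly_Mapping.map_key \<pi> \<alpha>) = f \<alpha>)"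
    and g: "(\<exists>d. \<forall>\<alpha>. g \<alpha> \<noteq> 0 \<longrightarrow> monom_degree \<alpha> \<le> d) \<and>
      (\<forall>\<pi> \<alpha>. bij \<pi> \<longrightarrow> g (Poly_Mapping.map_key \<pi> \<alpha>) = g \<alpha>)"
  from f g obtain d e where "\<forall>\<alpha>. f \<alpha> \<noteq> 0 \<longrightarrow> monom_degree \<alpha> \<le> d" "\<forall>\<alpha>. g \<alpha> \<noteq> 0 \<longrightarrow> monom_degree \<alpha> \<le> e"
    by blast
  then have "\<forall>\<alpha>. f \<alpha> + g \<alpha> \<noteq> 0 \<longrightarrow> monom_degree \<alpha> \<le> max d e"
    by (metis add.right_neutral max.coboundedI1 max.coboundedI2)
  with f g show "(\<exists>d. \<forall>\<alpha>. f \<alpha> + g \<alpha> \<noteq> 0 \<longrightarrow> monom_degree \<alpha> \<le> d) \<and>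
      (\<forall>\<pi> \<alpha>. bij \<pi> \<longrightarrow> f (Poly_Mapping.map_key \<pi> \<alpha>) + g (Poly_Mapping.map_key \<pi> \<alpha>) = f \<alpha> + g \<alpha>)"
    by auto
qed

lift_definition uminus_symfun :: "'a symfun \<Rightarrow> 'a symfun" is "\<lambda>f \<alpha>. - f \<alpha>" by simp

definition minus_symfun :: "'a symfun \<Rightarrow> 'a symfun \<Rightarrow> 'a symfun" where
  "minus_symfun f g = f + - g"

instance
proof
  fix a b c :: "'a symfun"
  show "a + b + c = a + (b + c)" by transfer (simp add: add.assoc)
  show "a + b = b + a" by transfer (simp add: add.commute)
  show "0 + a = a" by transfer simp
  show "- a + a = 0" by transfer simp
  show "a - b = a + - b" by (rule minus_symfun_def)
qed

end

lift_definition symfun_scale :: "'a :: comm_ring_1 \<Rightarrow> 'a symfun \<Rightarrow> 'a symfun" (infixr \<open>\<cdot>\<^sub>s\<close> 75)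
  is "\<lambda>c f \<alpha>. c * f \<alpha>"
proof -
  fix c :: 'a and f :: "(nat \<Rightarrow>\<^sub>0 nat) \<Rightarrow> 'a"
  assume f: "(\<exists>d. \<forall>\<alpha>. f \<alpha> \<noteq> 0 \<longrightarrow> monom_degree \<alpha> \<le> d) \<and>
      (\<forall>\<pi> \<alpha>. bij \<pi> \<longrightarrow> f (Poly_Mapping.map_key \<pi> \<alpha>) = f \<alpha>)"
  then obtain d where "\<forall>\<alpha>. f \<alpha> \<noteq> 0 \<longrightarrow> monom_degree \<alpha> \<le> d" by blast
  then have "\<forall>\<alpha>. c * f \<alpha> \<noteq> 0 \<longrightarrow> monom_degree \<alpha> \<le> d" by (metis mult_zero_right)
  with f show "(\<exists>d. \<forall>\<alpha>. c * f \<alpha> \<noteq> 0 \<longrightarrow> monom_degree \<alpha> \<le> d) \<and>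
      (\<forall>\<pi> \<alpha>. bij \<pi> \<longrightarrow> c * f (Poly_Mapping.map_key \<pi> \<alpha>) = c * f \<alpha>)"
    by auto
qed

interpretation symfun: module symfun_scale
proof
  fix a b :: 'a and x y :: "'a symfun"
  show "a \<cdot>\<^sub>s (x + y) = a \<cdot>\<^sub>s x + a \<cdot>\<^sub>s y" by transfer (simp add: distrib_left)
  show "(a + b) \<cdot>\<^sub>s x = a \<cdot>\<^sub>s x + b \<cdot>\<^sub>s x" by transfer (simp add: distrib_right)
  show "a \<cdot>\<^sub>s b \<cdot>\<^sub>s x = (a * b) \<cdot>\<^sub>s x" by transfer (simp add: mult.assoc)
  show "1 \<cdot>\<^sub>s x = x" by transfer simp
qed

lift_definition msym :: "nat list \<Rightarrow> 'a :: comm_ring_1 symfun"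
  is "\<lambda>\<nu> \<alpha>. if exp_mset \<alpha> = mset \<nu> then 1 else 0"
  by (auto simp: exp_mset_map_key simp flip: sum_mset_exp_mset)

definition msym_poly :: "nat \<Rightarrow> nat list \<Rightarrow> (nat \<Rightarrow>\<^sub>0 nat) \<Rightarrow>\<^sub>0 'a :: comm_ring_1" where
  "msym_poly N \<nu> =
     (\<Sum>\<alpha> | Poly_Mapping.keys \<alpha> \<subseteq> {..<N} \<and> exp_mset \<alpha> = mset \<nu>. Poly_Mapping.single \<alpha> 1)"

text \<open>Set to zero when \<open>\<nu>\<close> has more than \<open>N\<close> parts.\<close>

definition msym_aug :: "nat \<Rightarrow> nat list \<Rightarrow> 'a :: comm_ring_1 symfun" where
  "msym_aug N \<nu> =
     (if length \<nu> \<le> N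
      then of_nat ((\<Prod>i=1..sum_list \<nu>. fact (count_list \<nu> i)) * fact (N - length \<nu>)) \<cdot>\<^sub>s msym \<nu>
      else 0)"


section \<open>The $H$-chromatic symmetric function\<close>

definition labelings :: "'w pair_pre_digraph \<Rightarrow> ('w \<Rightarrow> nat) set" where
  "labelings H = {\<phi> \<in> extensional (pverts H). bij_betw \<phi> (pverts H) {..<card (pverts H)}}"

definition proper_colorings ::
  "'v pair_pre_digraph \<Rightarrow> 'w pair_pre_digraph \<Rightarrow> ('w \<Rightarrow> nat) \<Rightarrow> ('v \<Rightarrow> nat) set" where
  "proper_colorings G H \<phi> =
     {\<kappa> \<in> pverts G \<rightarrow>\<^sub>E {..<card (pverts H)}.
        \<forall>(u, v) \<in> parcs G. (inv_into (pverts H) \<phi> (\<kappa> u), inv_into (pverts H) \<phi> (\<kappa> v)) \<in> parcs H}"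

definition xvar :: "nat \<Rightarrow> (nat \<Rightarrow>\<^sub>0 nat) \<Rightarrow>\<^sub>0 'a :: comm_ring_1" where
  "xvar i = Poly_Mapping.single (Poly_Mapping.single i 1) 1"

definition hchrom_poly ::
  "'v pair_pre_digraph \<Rightarrow> 'w pair_pre_digraph \<Rightarrow> (nat \<Rightarrow>\<^sub>0 nat) \<Rightarrow>\<^sub>0 'a :: comm_ring_1" where
  "hchrom_poly G H =
     (\<Sum>\<phi>\<in>labelings H. \<Sum>\<kappa>\<in>proper_colorings G H \<phi>. \<Prod>v\<in>pverts G. xvar (\<kappa> v))"

text \<open>
  The coefficients of \<open>hchrom_poly G H\<close> in the basis of monomial symmetric polynomials; they exist
  and are unique by \<open>hchrom_coeff_ex1\<close> below. \<open>Poly_Mapping.single 0 c\<close> is the constant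
  polynomial \<open>c\<close>.
\<close>

definition is_hchrom_coeff ::
  "'v pair_pre_digraph \<Rightarrow> 'w pair_pre_digraph \<Rightarrow> (nat list \<Rightarrow> 'a :: comm_ring_1) \<Rightarrow> bool" where
  "is_hchrom_coeff G H c \<longleftrightarrow>
     (let P = partitions_le (card (pverts G)) (card (pverts H)) in
       (\<forall>\<mu>. \<mu> \<notin> P \<longrightarrow> c \<mu> = 0) \<and>
       hchrom_poly G H = (\<Sum>\<mu>\<in>P. Poly_Mapping.single 0 (c \<mu>) * msym_poly (card (pverts H)) \<mu>))"

definition hchrom_coeff ::
  "'v pair_pre_digraph \<Rightarrow> 'w pair_pre_digraph \<Rightarrow> nat list \<Rightarrow> 'a :: comm_ring_1" where
  "hchrom_coeff G H = (THE c. is_hchrom_coeff G H c)"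

definition hchrom_symfun ::
  "'v pair_pre_digraph \<Rightarrow> 'w pair_pre_digraph \<Rightarrow> 'a :: comm_ring_1 symfun" where
  "hchrom_symfun G H =
     (\<Sum>\<mu>\<in>partitions_le (card (pverts G)) (card (pverts H)). hchrom_coeff G H \<mu> \<cdot>\<^sub>s msym \<mu>)"


subsection \<open>Existence and uniqueness of the coefficients\<close>

lemma finite_monoms: "finite {\<alpha>. Poly_Mapping.keys \<alpha> \<subseteq> {..<N} \<and> exp_mset \<alpha> = M}"
proof (rule finite_imageD)
  let ?S = "{\<alpha>. Poly_Mapping.keys \<alpha> \<subseteq> {..<N} \<and> exp_mset \<alpha> = M}"
  let ?f = "\<lambda>\<alpha>. map (Poly_Mapping.lookup \<alpha>) [0..<N]"
  have "?f ` ?S \<subseteq> {xs. set xs \<subseteq> insert 0 (set_mset M) \<and> length xs = N}"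
    by (auto simp: exp_mset_def in_keys_iff) (metis image_eqI in_keys_iff)
  then show "finite (?f ` ?S)"
    by (rule finite_subset) (simp add: finite_lists_length_eq)
  show "inj_on ?f ?S"
  proof (rule inj_onI, rule poly_mapping_eqI)
    fix \<alpha> \<beta> i assume "\<alpha> \<in> ?S" "\<beta> \<in> ?S" and eq: "?f \<alpha> = ?f \<beta>"
    then have "i \<ge> N \<Longrightarrow> Poly_Mapping.lookup \<alpha> i = 0" "i \<ge> N \<Longrightarrow> Poly_Mapping.lookup \<beta> i = 0"
      by (auto simp: subset_iff in_keys_iff)
    moreover have "i < N \<Longrightarrow> Poly_Mapping.lookup \<alpha> i = Poly_Mapping.lookup \<beta> i"
      using eq by auto
    ultimately show "Poly_Mapping.lookup \<alpha> i = Poly_Mapping.lookup \<beta> i"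
      by (cases "i < N") auto
  qed
qed

lemma lookup_scaled_msym_poly:
  "Poly_Mapping.lookup (Poly_Mapping.single 0 c * msym_poly N \<nu>) \<alpha> =
     (if Poly_Mapping.keys \<alpha> \<subseteq> {..<N} \<and> exp_mset \<alpha> = mset \<nu> then c else 0)"
  using finite_monoms[of N "mset \<nu>"]
  by (simp add: msym_poly_def sum_distrib_left mult_single lookup_sum lookup_single when_def)

definition coloring_monom :: "'v pair_pre_digraph \<Rightarrow> ('v \<Rightarrow> nat) \<Rightarrow> nat \<Rightarrow>\<^sub>0 nat" where
  "coloring_monom G \<kappa> = (\<Sum>v\<in>pverts G. Poly_Mapping.single (\<kappa> v) 1)"

lemma prod_xvar: "(\<Prod>v\<in>pverts G. xvar (\<kappa> v)) = Poly_Mapping.single (coloring_monom G \<kappa>) 1"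
proof -
  have "(\<Prod>v\<in>A. xvar (\<kappa> v)) = Poly_Mapping.single (\<Sum>v\<in>A. Poly_Mapping.single (\<kappa> v) 1) 1" for A
    by (induction A rule: infinite_finite_induct) (simp_all add: xvar_def mult_single)
  then show ?thesis by (simp add: coloring_monom_def)
qed

lemma lookup_coloring_monom:
  assumes "finite (pverts G)"
  shows "Poly_Mapping.lookup (coloring_monom G \<kappa>) i = card {v \<in> pverts G. \<kappa> v = i}"
  using assms by (simp add: coloring_monom_def lookup_sum lookup_single when_def
      sum.If_cases Int_def)

lemma finite_labelings: "finite (pverts H) \<Longrightarrow> finite (labelings H)"
  by (rule finite_subset[OF _ finite_PiE[of "pverts H" "\<lambda>_. {..<card (pverts H)}"]])
     (auto simp: labelings_def bij_betw_def PiE_def Pi_def)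

lemma finite_proper_colorings: "finite (pverts G) \<Longrightarrow> finite (proper_colorings G H \<phi>)"
  by (rule finite_subset[OF _ finite_PiE[of "pverts G" "\<lambda>_. {..<card (pverts H)}"]])
     (auto simp: proper_colorings_def)

definition colored_labelings where
  "colored_labelings G H \<alpha> =
     {(\<phi>, \<kappa>). \<phi> \<in> labelings H \<and> \<kappa> \<in> proper_colorings G H \<phi> \<and> coloring_monom G \<kappa> = \<alpha>}"

lemma finite_colored_labelings:
  assumes "finite (pverts G)" "finite (pverts H)"
  shows "finite (colored_labelings G H \<alpha>)"
  by (rule finite_subset[OF _ finite_SigmaI[OF finite_labelings[OF assms(2)]
          finite_proper_colorings[OF assms(1)]]])
     (auto simp: colored_labelings_def)

lemma lookup_hchrom_poly:
  assumes "finite (pverts G)" "finite (pverts H)"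
  shows "Poly_Mapping.lookup (hchrom_poly G H :: _ \<Rightarrow>\<^sub>0 'a :: comm_ring_1) \<alpha>
           = of_nat (card (colored_labelings G H \<alpha>))"
proof -
  have "Poly_Mapping.lookup (hchrom_poly G H :: _ \<Rightarrow>\<^sub>0 'a) \<alpha> =
     (\<Sum>\<phi>\<in>labelings H. \<Sum>\<kappa>\<in>proper_colorings G H \<phi>. if coloring_monom G \<kappa> = \<alpha> then 1 else 0)"
    by (simp add: hchrom_poly_def prod_xvar lookup_sum lookup_single when_def)
  also have "\<dots> = (\<Sum>(\<phi>, \<kappa>)\<in>Sigma (labelings H) (proper_colorings G H).
                     if coloring_monom G \<kappa> = \<alpha> then 1 else 0)"
    by (rule sum.Sigma) (auto simp: finite_labelings finite_proper_colorings assms)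
  also have "\<dots> = (\<Sum>_\<in>colored_labelings G H \<alpha>. 1)"
    by (rule sum.mono_neutral_cong_right)
       (auto simp: colored_labelings_def finite_labelings finite_proper_colorings assms
          split: if_splits)
  finally show ?thesis by simp
qed

lemma colored_labelings_nonempty:
  assumes "finite (pverts G)" "colored_labelings G H \<alpha> \<noteq> {}"
  shows "Poly_Mapping.keys \<alpha> \<subseteq> {..<card (pverts H)}" "monom_degree \<alpha> = card (pverts G)"
proof -
  from assms(2) obtain \<kappa> where \<kappa>: "\<kappa> \<in> pverts G \<rightarrow>\<^sub>E {..<card (pverts H)}" "coloring_monom G \<kappa> = \<alpha>"
    by (auto simp: colored_labelings_def proper_colorings_def)
  have l: "Poly_Mapping.lookup \<alpha> i = card {v \<in> pverts G. \<kappa> v = i}" for i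
    using lookup_coloring_monom[OF assms(1)] \<kappa>(2) by blast
  have keys: "Poly_Mapping.keys \<alpha> = \<kappa> ` pverts G"
    using assms(1) by (auto simp: in_keys_iff l)
  then show "Poly_Mapping.keys \<alpha> \<subseteq> {..<card (pverts H)}" using \<kappa> by auto
  show "monom_degree \<alpha> = card (pverts G)"
    unfolding monom_degree_def keys l
    using sum.image_gen[OF assms(1), of "\<lambda>_. 1 :: nat" \<kappa>] by simp
qed

lemma card_colored_labelings_le:
  assumes G: "finite (pverts G)" "pair_wf_digraph G" and H: "finite (pverts H)"
    and \<alpha>: "Poly_Mapping.keys \<alpha> \<subseteq> {..<card (pverts H)}"
    and \<beta>: "Poly_Mapping.keys \<beta> \<subseteq> {..<card (pverts H)}"
    and eq: "exp_mset \<alpha> = exp_mset \<beta>"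
  shows "card (colored_labelings G H \<alpha>) \<le> card (colored_labelings G H \<beta>)"
proof -
  let ?N = "card (pverts H)"
  have full: "image_mset (Poly_Mapping.lookup \<gamma>) (mset_set {..<?N})
      = exp_mset \<gamma> + replicate_mset (?N - size (exp_mset \<gamma>)) 0"
    if "Poly_Mapping.keys \<gamma> \<subseteq> {..<?N}" for \<gamma> :: "nat \<Rightarrow>\<^sub>0 nat"
  proof -
    let ?K = "Poly_Mapping.keys \<gamma>"
    have "mset_set {..<?N} = mset_set ?K + mset_set ({..<?N} - ?K)"
      using that by (subst mset_set_Union[symmetric]) (auto intro: arg_cong[of _ _ mset_set])
    moreover have "image_mset (Poly_Mapping.lookup \<gamma>) (mset_set ({..<?N} - ?K))
        = image_mset (\<lambda>_. 0) (mset_set ({..<?N} - ?K))"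
      by (rule image_mset_cong) (auto simp: in_keys_iff)
    moreover have "card ({..<?N} - ?K) = ?N - size (exp_mset \<gamma>)"
      using that by (simp add: card_Diff_subset exp_mset_def)
    ultimately show ?thesis
      by (simp add: exp_mset_def image_mset_const_eq)
  qed
  have "image_mset (Poly_Mapping.lookup \<alpha>) (mset_set {..<?N})
      = image_mset (Poly_Mapping.lookup \<beta>) (mset_set {..<?N})"
    using full[OF \<alpha>] full[OF \<beta>] eq by simp
  from image_mset_eq_implies_permutes[OF _ this]
  obtain p where p: "p permutes {..<?N}"
    and pl: "\<forall>i\<in>{..<?N}. Poly_Mapping.lookup \<alpha> i = Poly_Mapping.lookup \<beta> (p i)"
    by auto
  have pN: "p i < ?N \<longleftrightarrow> i < ?N" for i
    using permutes_in_image[OF p, of i] by simp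
  have pinj: "p i = p j \<longleftrightarrow> i = j" for i j
    using permutes_inj[OF p] by (auto dest: injD)
  have lp: "Poly_Mapping.lookup \<beta> (p i) = Poly_Mapping.lookup \<alpha> i" for i
  proof (cases "i < ?N")
    case True then show ?thesis using pl by simp
  next
    case False
    then have "i \<notin> Poly_Mapping.keys \<alpha>" "p i \<notin> Poly_Mapping.keys \<beta>"
      using \<alpha> \<beta> pN by (auto simp: subset_iff)
    then show ?thesis by (simp add: in_keys_iff)
  qed
  let ?f = "\<lambda>(\<phi>, \<kappa>). (restrict (p \<circ> \<phi>) (pverts H), restrict (p \<circ> \<kappa>) (pverts G))"
  show ?thesis
  proof (rule card_inj_on_le[where f = ?f])
    show "finite (colored_labelings G H \<beta>)"
      by (rule finite_colored_labelings[OF G(1) H])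
    show "inj_on ?f (colored_labelings G H \<alpha>)"
    proof (rule inj_onI, clarify)
      fix \<phi> \<kappa> \<phi>' \<kappa>'
      assume in1: "(\<phi>, \<kappa>) \<in> colored_labelings G H \<alpha>" and in2: "(\<phi>', \<kappa>') \<in> colored_labelings G H \<alpha>"
        and e1: "restrict (p \<circ> \<phi>) (pverts H) = restrict (p \<circ> \<phi>') (pverts H)"
        and e2: "restrict (p \<circ> \<kappa>) (pverts G) = restrict (p \<circ> \<kappa>') (pverts G)"
      have "\<phi> x = \<phi>' x" if "x \<in> pverts H" for x
        using fun_cong[OF e1, of x] that pinj by simp
      moreover have "\<kappa> x = \<kappa>' x" if "x \<in> pverts G" for x
        using fun_cong[OF e2, of x] that pinj by simp
      ultimately show "\<phi> = \<phi>' \<and> \<kappa> = \<kappa>'"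
        using in1 in2 unfolding colored_labelings_def labelings_def proper_colorings_def PiE_def
        by (auto intro: extensionalityI)
    qed
    show "?f ` colored_labelings G H \<alpha> \<subseteq> colored_labelings G H \<beta>"
    proof clarify
      fix \<phi> \<kappa> assume "(\<phi>, \<kappa>) \<in> colored_labelings G H \<alpha>"
      then have bij: "bij_betw \<phi> (pverts H) {..<?N}" and ran: "\<kappa> \<in> pverts G \<rightarrow>\<^sub>E {..<?N}"
        and proper: "\<And>u v. (u, v) \<in> parcs G \<Longrightarrow>
          (inv_into (pverts H) \<phi> (\<kappa> u), inv_into (pverts H) \<phi> (\<kappa> v)) \<in> parcs H"
        and mon: "coloring_monom G \<kappa> = \<alpha>"
        by (auto simp: colored_labelings_def labelings_def proper_colorings_def)
      let ?\<phi> = "restrict (p \<circ> \<phi>) (pverts H)" and ?\<kappa> = "restrict (p \<circ> \<kappa>) (pverts G)"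
      have bij': "bij_betw ?\<phi> (pverts H) {..<?N}"
        using bij_betw_trans[OF bij permutes_imp_bij[OF p]]
        by (subst bij_betw_cong[where g = "p \<circ> \<phi>"]) auto
      have inv: "inv_into (pverts H) ?\<phi> (?\<kappa> u) = inv_into (pverts H) \<phi> (\<kappa> u)"
        if u: "u \<in> pverts G" for u
      proof (rule inv_into_f_eq)
        show "inj_on ?\<phi> (pverts H)" using bij' by (simp add: bij_betw_def)
        have im: "\<kappa> u \<in> \<phi> ` pverts H" using ran u bij by (auto simp: bij_betw_def)
        then show v: "inv_into (pverts H) \<phi> (\<kappa> u) \<in> pverts H" by (rule inv_into_into)
        show "?\<phi> (inv_into (pverts H) \<phi> (\<kappa> u)) = ?\<kappa> u"
          using v u f_inv_into_f[OF im] by simp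
      qed
      have mon': "coloring_monom G ?\<kappa> = \<beta>"
      proof (rule poly_mapping_eqI)
        fix i
        obtain j where j: "i = p j" using permutes_surj[OF p] by blast
        have "Poly_Mapping.lookup (coloring_monom G ?\<kappa>) i = card {v \<in> pverts G. ?\<kappa> v = p j}"
          by (simp only: lookup_coloring_monom[OF G(1)] j)
        also have "{v \<in> pverts G. ?\<kappa> v = p j} = {v \<in> pverts G. \<kappa> v = j}"
          using pinj by auto
        also have "card \<dots> = Poly_Mapping.lookup \<alpha> j"
          using mon lookup_coloring_monom[OF G(1)] by metis
        finally show "Poly_Mapping.lookup (coloring_monom G ?\<kappa>) i = Poly_Mapping.lookup \<beta> i"
          by (simp only: j lp)
      qed
      have "?\<kappa> \<in> pverts G \<rightarrow>\<^sub>E {..<?N}" using ran pN by (auto simp: PiE_iff)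
      moreover have "(inv_into (pverts H) ?\<phi> (?\<kappa> u), inv_into (pverts H) ?\<phi> (?\<kappa> v)) \<in> parcs H"
        if uv: "(u, v) \<in> parcs G" for u v
        using proper[OF uv] inv pair_wf_digraph.in_arcsD1[OF G(2) uv] pair_wf_digraph.in_arcsD2[OF G(2) uv]
        by simp
      ultimately have "?\<kappa> \<in> proper_colorings G H ?\<phi>"
        unfolding proper_colorings_def by blast
      then show "(?\<phi>, ?\<kappa>) \<in> colored_labelings G H \<beta>"
        using bij' mon' by (simp add: colored_labelings_def labelings_def)
    qed
  qed
qed

lemma ex_monom_of_partition:
  assumes "\<mu> \<in> partitions_le k N"
  shows "\<exists>\<alpha>. Poly_Mapping.keys \<alpha> \<subseteq> {..<N} \<and> exp_mset \<alpha> = mset \<mu>"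
proof -
  let ?f = "\<lambda>i. if i < length \<mu> then \<mu> ! i else 0"
  have "0 \<notin> set \<mu>" using assms by (simp add: partitions_le_def is_partition_def)
  then have nz: "\<mu> ! i \<noteq> 0" if "i < length \<mu>" for i
    using nth_mem[OF that] by metis
  have fin: "finite {i. ?f i \<noteq> 0}" by (rule finite_subset[of _ "{..<length \<mu>}"]) auto
  have l: "Poly_Mapping.lookup (Abs_poly_mapping ?f) = ?f"
    using fin by (simp add: Abs_poly_mapping_inverse)
  have k: "Poly_Mapping.keys (Abs_poly_mapping ?f) = {..<length \<mu>}"
    using nz by (auto simp: set_eq_iff in_keys_iff l)
  have "exp_mset (Abs_poly_mapping ?f) = image_mset ((!) \<mu>) (mset_set {..<length \<mu>})"
    unfolding exp_mset_def k l by (rule image_mset_cong) auto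
  also have "\<dots> = mset (map ((!) \<mu>) [0..<length \<mu>])"
    by (simp add: atLeast0LessThan)
  also have "\<dots> = mset \<mu>" by (simp only: map_nth)
  finally have "exp_mset (Abs_poly_mapping ?f) = mset \<mu>" .
  moreover have "length \<mu> \<le> N" using assms by (simp add: partitions_le_def)
  ultimately show ?thesis using k by (intro exI[of _ "Abs_poly_mapping ?f"]) auto
qed

lemma ex_partition_of_monom:
  assumes "Poly_Mapping.keys \<alpha> \<subseteq> {..<N}" "monom_degree \<alpha> = k"
  shows "\<exists>\<mu>\<in>partitions_le k N. exp_mset \<alpha> = mset \<mu>"
proof
  let ?\<mu> = "rev (sorted_list_of_multiset (exp_mset \<alpha>))"
  show eq: "exp_mset \<alpha> = mset ?\<mu>" by simp
  have "sum_list ?\<mu> = k"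
    using sum_mset_sum_list[of ?\<mu>] assms(2) unfolding eq[symmetric] sum_mset_exp_mset by simp
  moreover have "0 \<notin> set ?\<mu>" by (auto simp: exp_mset_def in_keys_iff)
  moreover have "sorted_wrt (\<ge>) ?\<mu>" by (simp add: sorted_wrt_rev)
  moreover have "length ?\<mu> = card (Poly_Mapping.keys \<alpha>)"
    by (simp flip: size_mset add: exp_mset_def)
  moreover have "card (Poly_Mapping.keys \<alpha>) \<le> N"
    using card_mono[OF _ assms(1)] by simp
  ultimately show "?\<mu> \<in> partitions_le k N"
    by (simp add: partitions_le_def is_partition_def)
qed

theorem hchrom_coeff_ex1:
  assumes G: "simple_graph G" and H: "simple_graph H"
  shows "\<exists>!c :: nat list \<Rightarrow> 'a :: comm_ring_1. is_hchrom_coeff G H c"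
proof -
  let ?N = "card (pverts H)" and ?k = "card (pverts G)"
  let ?P = "partitions_le ?k ?N"
  let ?w = "hchrom_poly G H :: _ \<Rightarrow>\<^sub>0 'a"
  have pG: "pair_graph G" and pH: "pair_graph H"
    using G H by (auto simp: simple_graph_def)
  interpret G: pair_graph G by fact
  interpret H: pair_graph H by fact
  note finG = G.pair_finite_verts and finH = H.pair_finite_verts
  have wfG: "pair_wf_digraph G" by unfold_locales
  have rhs: "Poly_Mapping.lookup (\<Sum>\<mu>\<in>?P. Poly_Mapping.single 0 (c \<mu>) * msym_poly ?N \<mu>) \<alpha>
      = (if Poly_Mapping.keys \<alpha> \<subseteq> {..<?N} then c \<mu> else 0)"
    if "\<mu> \<in> ?P" "exp_mset \<alpha> = mset \<mu>" for c :: "nat list \<Rightarrow> 'a" and \<alpha> \<mu>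
  proof -
    have "exp_mset \<alpha> = mset \<nu> \<longleftrightarrow> \<nu> = \<mu>" if "\<nu> \<in> ?P" for \<nu>
      using partition_eqI[of \<nu> ?k \<mu> ?k] that \<open>\<mu> \<in> ?P\<close> \<open>exp_mset \<alpha> = mset \<mu>\<close>
      unfolding partitions_le_def mem_Collect_eq by metis
    then have "Poly_Mapping.lookup (\<Sum>\<nu>\<in>?P. Poly_Mapping.single 0 (c \<nu>) * msym_poly ?N \<nu>) \<alpha>
        = (\<Sum>\<nu>\<in>?P. if \<nu> = \<mu> then (if Poly_Mapping.keys \<alpha> \<subseteq> {..<?N} then c \<mu> else 0) else 0)"
      unfolding lookup_sum lookup_scaled_msym_poly by (intro sum.cong) auto
    then show ?thesis using \<open>\<mu> \<in> ?P\<close> finite_partitions_le by simp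
  qed
  define mon where "mon \<mu> = (SOME \<alpha>. Poly_Mapping.keys \<alpha> \<subseteq> {..<?N} \<and> exp_mset \<alpha> = mset \<mu>)" for \<mu>
  have mon: "Poly_Mapping.keys (mon \<mu>) \<subseteq> {..<?N}" "exp_mset (mon \<mu>) = mset \<mu>" if "\<mu> \<in> ?P" for \<mu>
    using someI_ex[OF ex_monom_of_partition[OF that]] by (auto simp: mon_def)
  define c where "c \<mu> = (if \<mu> \<in> ?P then Poly_Mapping.lookup ?w (mon \<mu>) else 0)" for \<mu>
  show ?thesis
  proof (rule ex1I[of _ c])
    have "?w = (\<Sum>\<mu>\<in>?P. Poly_Mapping.single 0 (c \<mu>) * msym_poly ?N \<mu>)" (is "_ = ?r")
    proof (rule poly_mapping_eqI)
      fix \<alpha>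
      show "Poly_Mapping.lookup ?w \<alpha> = Poly_Mapping.lookup ?r \<alpha>"
      proof (cases "Poly_Mapping.keys \<alpha> \<subseteq> {..<?N} \<and> monom_degree \<alpha> = ?k")
        case True
        then obtain \<mu> where \<mu>: "\<mu> \<in> ?P" "exp_mset \<alpha> = mset \<mu>"
          using ex_partition_of_monom by blast
        have "card (colored_labelings G H \<alpha>) = card (colored_labelings G H (mon \<mu>))"
          using card_colored_labelings_le[OF finG wfG finH] True mon[OF \<mu>(1)] \<mu>(2)
          by (simp add: order.antisym)
        then show ?thesis
          using True \<mu>(1) unfolding rhs[OF \<mu>] c_def lookup_hchrom_poly[OF finG finH] by simp
      next
        case False
        then have "colored_labelings G H \<alpha> = {}"
          using colored_labelings_nonempty[OF finG] by blast
        then have "Poly_Mapping.lookup ?w \<alpha> = 0"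
          by (simp add: lookup_hchrom_poly[OF finG finH])
        moreover have "Poly_Mapping.lookup ?r \<alpha> = 0"
          unfolding lookup_sum lookup_scaled_msym_poly
        proof (rule sum.neutral, rule ballI)
          fix \<mu> assume "\<mu> \<in> ?P"
          then have "exp_mset \<alpha> = mset \<mu> \<Longrightarrow> monom_degree \<alpha> = ?k"
            by (simp add: sum_mset_sum_list partitions_le_def is_partition_def
                flip: sum_mset_exp_mset)
          with False show "(if Poly_Mapping.keys \<alpha> \<subseteq> {..<?N} \<and> exp_mset \<alpha> = mset \<mu> then c \<mu> else 0) = 0"
            by auto
        qed
        ultimately show ?thesis by simp
      qed
    qed
    then show "is_hchrom_coeff G H c"
      by (simp add: is_hchrom_coeff_def c_def Let_def)
  next
    fix d :: "nat list \<Rightarrow> 'a" assume d: "is_hchrom_coeff G H d"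
    show "d = c"
    proof
      fix \<mu>
      show "d \<mu> = c \<mu>"
      proof (cases "\<mu> \<in> ?P")
        case True
        have "?w = (\<Sum>\<mu>\<in>?P. Poly_Mapping.single 0 (d \<mu>) * msym_poly ?N \<mu>)"
          using d by (simp add: is_hchrom_coeff_def Let_def)
        then show ?thesis
          using rhs[OF True mon(2)[OF True], of d] mon(1)[OF True] True by (simp add: c_def)
      next
        case False
        then show ?thesis using d by (simp add: is_hchrom_coeff_def Let_def c_def)
      qed
    qed
  qed
qed

lemma is_hchrom_coeff_hchrom_coeff:
  assumes "simple_graph G" "simple_graph H"
  shows "is_hchrom_coeff G H (hchrom_coeff G H :: nat list \<Rightarrow> 'a :: comm_ring_1)"
  unfolding hchrom_coeff_def by (rule theI'[OF hchrom_coeff_ex1[OF assms]])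

end

theory Submission
  imports Defs
begin

text \<open>
  If \<open>H\<close> has no \<open>K\<^bsub>n+1\<^esub>\<close> minus an edge, every proper coloring of \<open>K\<^sub>\<nu>\<close> is constant on parts. A labeling
  \<open>\<phi>\<close> of \<open>H\<close> with a proper coloring of monomial \<open>\<alpha>\<close> is therefore a choice of one colour \<open>c i\<close> per
  part with exponent \<open>\<nu> ! i\<close> in \<open>\<alpha>\<close>, an embedding \<open>g\<close> of \<open>K\<^sub>n\<close> into \<open>H\<close>, and an extension of the partial
  labeling \<open>g i \<mapsto> c i\<close> to all of \<open>H\<close>. When the exponents of \<open>\<alpha>\<close> are the parts of \<open>\<nu>\<close>, there are
  \<open>\<Prod>j. r\<^sub>j(\<nu>)!\<close>, \<open>m n!\<close> and \<open>(N - n)!\<close> of these, respectively; otherwise there is no such \<open>c\<close>.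
\<close>

section \<open>Colour-preserving bijections\<close>

text \<open>Two counts have this shape: the colours given to the parts, with \<open>f\<close> the
  part sizes and \<open>g\<close> the exponents, and the labelings that extend a partial labeling.
  \<open>extensional A\<close> fixes the values off \<open>A\<close>, so cardinalities count
  bijections of \<open>A\<close>.\<close>

definition bijections_over ::
  "'a set \<Rightarrow> ('a \<Rightarrow> 'c) \<Rightarrow> 'b set \<Rightarrow> ('b \<Rightarrow> 'c) \<Rightarrow> ('a \<Rightarrow> 'b) set" where
  "bijections_over A f B g =
     {h \<in> extensional A. bij_betw h A B \<and> (\<forall>a\<in>A. g (h a) = f a)}"

lemma count_image_mset_set:
  assumes "finite A"
  shows "count (image_mset f (mset_set A)) y = card {a \<in> A. f a = y}"
  using assms by (simp add: count_image_mset Int_def conj_commute)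

lemma finite_bijections_over:
  assumes "finite A" "finite B"
  shows "finite (bijections_over A f B g)"
  by (rule finite_subset[OF _ finite_PiE[of A "\<lambda>_. B"]])
     (use assms in \<open>auto simp: bijections_over_def bij_betw_def PiE_def Pi_def\<close>)

text \<open>Recursion for the count: \<open>a\<close> may go to any \<open>b\<close> of its own
  colour, and what remains is a bijection from \<open>A\<close> onto \<open>B - {b}\<close>.
  Resetting the value at \<open>a\<close> to \<open>undefined\<close> keeps the restricted map
  extensional.\<close>

lemma bijections_over_insert:
  assumes "a \<notin> A"
  shows "bij_betw (\<lambda>(b, h). h(a := b))
           (SIGMA b:{b \<in> B. g b = f a}. bijections_over A f (B - {b}) g)
           (bijections_over (insert a A) f B g)"
proof (rule bij_betw_byWitness[where f' = "\<lambda>h. (h a, h(a := undefined))"])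
  let ?S = "SIGMA b:{b \<in> B. g b = f a}. bijections_over A f (B - {b}) g"
  show "\<forall>p\<in>?S. (\<lambda>h. (h a, h(a := undefined))) ((\<lambda>(b, h). h(a := b)) p) = p"
    using assms by (auto simp: bijections_over_def extensional_def fun_eq_iff)
  show "\<forall>h\<in>bijections_over (insert a A) f B g.
      (\<lambda>(b, h). h(a := b)) (h a, h(a := undefined)) = h"
    by auto
  show "(\<lambda>(b, h). h(a := b)) ` ?S \<subseteq> bijections_over (insert a A) f B g"
  proof clarify
    fix b h assume b: "b \<in> B" "g b = f a" and h: "h \<in> bijections_over A f (B - {b}) g"
    have "bij_betw (h(a := b)) A (B - {b})"
      using h assms by (subst bij_betw_cong[where g = h]) (auto simp: bijections_over_def)
    then have "bij_betw (h(a := b)) (A \<union> {a}) ((B - {b}) \<union> {b})"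
      using notIn_Un_bij_betw[of a A "h(a := b)" "B - {b}"] assms by simp
    moreover have "(B - {b}) \<union> {b} = B" using b by auto
    ultimately show "h(a := b) \<in> bijections_over (insert a A) f B g"
      using b h assms by (auto simp: bijections_over_def extensional_def)
  qed
  show "(\<lambda>h. (h a, h(a := undefined))) ` bijections_over (insert a A) f B g \<subseteq> ?S"
  proof clarify
    fix h assume "h \<in> bijections_over (insert a A) f B g"
    then have h: "h \<in> extensional (insert a A)" "bij_betw h (insert a A) B"
      "\<And>x. x \<in> insert a A \<Longrightarrow> g (h x) = f x"
      by (auto simp: bijections_over_def)
    have "bij_betw h A (B - {h a})"
      using bij_betw_subset[OF h(2), of A "h ` A"] h(2) assms
      by (auto simp: bij_betw_def inj_on_def)
    then have "bij_betw (h(a := undefined)) A (B - {h a})"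
      using assms by (subst bij_betw_cong[where g = h]) auto
    then show "h a \<in> {b \<in> B. g b = f a} \<and>
        h(a := undefined) \<in> bijections_over A f (B - {h a}) g"
      using h assms by (auto simp: bijections_over_def extensional_def bij_betw_def)
  qed
qed

text \<open>Each fibre of \<open>f\<close> is matched with the fibre of \<open>g\<close> of the same
  colour and size. In the induction a new element whose colour occurs \<open>r\<close> times so far
  has \<open>r + 1\<close> possible images, turning \<open>fact r\<close> into
  \<open>fact (r + 1)\<close>. Colours in \<open>S\<close> outside the image contribute
  \<open>fact 0 = 1\<close>, so \<open>S\<close> can stay fixed.\<close>

lemma card_bijections_over:
  assumes "finite A" "finite B" "finite S" "f ` A \<subseteq> S"
    and "image_mset f (mset_set A) = image_mset g (mset_set B)"
  shows "card (bijections_over A f B g) = (\<Prod>y\<in>S. fact (count (image_mset f (mset_set A)) y))"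
  using assms
proof (induction A arbitrary: B rule: finite_induct)
  case empty
  then have "B = {}" by (simp add: mset_set_empty_iff)
  then have "bijections_over {} f B g = {\<lambda>_. undefined}"
    by (auto simp: bijections_over_def bij_betw_def)
  then show ?case by simp
next
  case (insert a A)
  let ?M = "image_mset f (mset_set A)"
  have S: "f a \<in> S" "f ` A \<subseteq> S" using insert.prems by auto
  \<comment> \<open>Removing \<open>a\<close> and \<open>b\<close> takes the same colour out of both
    multisets, so they stay equal and the induction hypothesis applies.\<close>
  have step: "card (bijections_over A f (B - {b}) g) = (\<Prod>y\<in>S. fact (count ?M y))"
    if b: "b \<in> B" "g b = f a" for b
  proof (rule insert.IH)
    have "image_mset g (mset_set B) = add_mset (g b) (image_mset g (mset_set (B - {b})))"
      using b insert.prems(1) by (simp add: mset_set.remove)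
    then show "?M = image_mset g (mset_set (B - {b}))"
      using insert.prems insert.hyps b by simp
  qed (use insert.prems S in auto)
  have "card {b \<in> B. g b = f a} = Suc (count ?M (f a))"
    using count_image_mset_set[OF insert.prems(1), of g "f a"] insert.prems(4) insert.hyps
    by (simp flip: insert.prems(4))
  then have "card (bijections_over (insert a A) f B g)
      = Suc (count ?M (f a)) * (\<Prod>y\<in>S. fact (count ?M y))"
    using bij_betw_same_card[OF bijections_over_insert[OF insert.hyps(2), of B g f]]
      insert.prems(1) insert.hyps
    by (simp add: card_SigmaI finite_bijections_over step)
  also have "\<dots> = (\<Prod>y\<in>S. fact (count (image_mset f (mset_set (insert a A))) y))"
  proof -
    have "(\<Prod>y\<in>S - {f a}. fact (count (add_mset (f a) ?M) y))
        = (\<Prod>y\<in>S - {f a}. fact (count ?M y) :: nat)"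
      by (rule prod.cong) auto
    then show ?thesis
      using insert.hyps prod.remove[OF insert.prems(2) S(1), of "\<lambda>y. fact (count ?M y) :: nat"]
        prod.remove[OF insert.prems(2) S(1), of "\<lambda>y. fact (count (add_mset (f a) ?M) y) :: nat"]
      by (simp del: mult_Suc add: mult.assoc)
  qed
  finally show ?case .
qed

lemma card_bij_betw_extensional:
  assumes "finite A" "finite B" "card A = card B"
  shows "card {h \<in> extensional A. bij_betw h A B} = fact (card A)"
proof -
  have "{h \<in> extensional A. bij_betw h A B} = bijections_over A (\<lambda>_. True) B (\<lambda>_. True)"
    by (simp add: bijections_over_def)
  then show ?thesis
    using card_bijections_over[of A B "{True}" "\<lambda>_. True" "\<lambda>_. True"] assms
    by (auto simp add: image_mset_const_eq)
qed

text \<open>A prescribed value is turned into a colour condition: each prescribed point gets a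
  colour of its own, and all free points share the colour \<open>None\<close>. Only the fibre over
  \<open>None\<close> then contributes a nontrivial factorial.\<close>

lemma card_bij_betw_extending:
  assumes fin: "finite A" "finite B" and card: "card A = card B"
    and g: "inj_on g I" "g ` I \<subseteq> A" and c: "inj_on c I" "c ` I \<subseteq> B"
  shows "card {h \<in> extensional A. bij_betw h A B \<and> (\<forall>i\<in>I. h (g i) = c i)}
           = fact (card A - card I)"
proof -
  define f where "f a = (if a \<in> g ` I then Some (c (inv_into I g a)) else None)" for a
  define f' where "f' b = (if b \<in> c ` I then Some b else None)" for b
  have fg: "f (g i) = Some (c i)" if "i \<in> I" for i
    using that g(1) by (simp add: f_def)
  have finI: "finite I"
    using finite_imageD[OF finite_subset[OF g(2) fin(1)] g(1)] .
  have "{h \<in> extensional A. bij_betw h A B \<and> (\<forall>i\<in>I. h (g i) = c i)} = bijections_over A f B f'"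
  proof (intro set_eqI iffI)
    fix h assume h: "h \<in> {h \<in> extensional A. bij_betw h A B \<and> (\<forall>i\<in>I. h (g i) = c i)}"
    have "f' (h a) = f a" if a: "a \<in> A" for a
    proof (cases "a \<in> g ` I")
      case True
      then show ?thesis using h fg by (auto simp: f'_def)
    next
      case False
      \<comment> \<open>A prescribed value is already taken by some \<open>g i\<close>, so
        injectivity keeps free points away from it.\<close>
      have "h a \<notin> c ` I"
      proof
        assume "h a \<in> c ` I"
        then obtain i where "i \<in> I" "h a = h (g i)" using h by auto
        moreover have "inj_on h A" using h by (simp add: bij_betw_def)
        ultimately show False using False a g(2) by (metis imageI inj_onD subsetD)
      qed
      then show ?thesis using False by (simp add: f_def f'_def)
    qed
    then show "h \<in> bijections_over A f B f'" using h by (simp add: bijections_over_def)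
  next
    fix h assume h: "h \<in> bijections_over A f B f'"
    have "h (g i) = c i" if i: "i \<in> I" for i
    proof -
      have "f' (h (g i)) = f (g i)" using h i g(2) by (auto simp: bijections_over_def)
      then show ?thesis using fg[OF i] by (simp add: f'_def split: if_splits)
    qed
    then show "h \<in> {h \<in> extensional A. bij_betw h A B \<and> (\<forall>i\<in>I. h (g i) = c i)}"
      using h by (simp add: bijections_over_def)
  qed
  \<comment> \<open>The fibres of \<open>f\<close> and of \<open>f'\<close> are shown to have the
    same sizes, which is the multiset equality that \<open>card_bijections_over\<close> asks
    for.\<close>
  moreover have cntf: "card {a \<in> A. f a = y} = (case y of None \<Rightarrow> card A - card I
      | Some b \<Rightarrow> if b \<in> c ` I then 1 else 0)" for y
  proof (cases y)
    case None
    have "{a \<in> A. f a = None} = A - g ` I" by (auto simp: f_def)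
    then show ?thesis
      using None g fin(1) finI by (simp add: card_Diff_subset card_image)
  next
    case (Some b)
    have "a \<in> A \<and> f a = Some b \<longleftrightarrow> a \<in> g ` {i \<in> I. c i = b}" for a
    proof (cases "a \<in> g ` I")
      case True
      then obtain i where "i \<in> I" "a = g i" by blast
      then show ?thesis using fg g by (auto dest: inj_onD)
    qed (auto simp: f_def)
    then have "{a \<in> A. f a = Some b} = g ` {i \<in> I. c i = b}" by blast
    also have "{i \<in> I. c i = b} = (if b \<in> c ` I then {inv_into I c b} else {})"
    proof (cases "b \<in> c ` I")
      case True
      then obtain i where i: "i \<in> I" "b = c i" by blast
      then have "{i \<in> I. c i = b} = {i}" using c(1) by (auto dest: inj_onD)
      then show ?thesis using i c(1) by simp
    qed auto
    finally show ?thesis using Some by simp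
  qed
  moreover have "card {b \<in> B. f' b = y} = (case y of None \<Rightarrow> card A - card I
      | Some b \<Rightarrow> if b \<in> c ` I then 1 else 0)" for y
  proof (cases y)
    case None
    have "{b \<in> B. f' b = None} = B - c ` I" by (auto simp: f'_def)
    then show ?thesis
      using None c card fin(2) finI by (simp add: card_Diff_subset card_image)
  next
    case (Some b)
    have "{b' \<in> B. f' b' = Some b} = (if b \<in> c ` I then {b} else {})"
      using c(2) by (auto simp: f'_def split: if_splits)
    then show ?thesis using Some by simp
  qed
  ultimately have "card {h \<in> extensional A. bij_betw h A B \<and> (\<forall>i\<in>I. h (g i) = c i)}
      = (\<Prod>y\<in>insert None (f ` A). fact (count (image_mset f (mset_set A)) y))"
    using fin by (subst card_bijections_over[symmetric, where B = B and g = f'])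
      (auto simp: multiset_eq_iff count_image_mset_set)
  \<comment> \<open>Fibres over \<open>Some b\<close> have at most one element, hence factor 1.
    Inserting \<open>None\<close> is harmless if there are no free points, since then its factor is
    \<open>fact 0\<close>.\<close>
  also have "\<dots> = (\<Prod>y\<in>insert None (f ` A). if y = None then fact (card A - card I) else 1)"
    using fin(1) by (intro prod.cong) (auto simp: count_image_mset_set cntf split: option.split)
  also have "\<dots> = fact (card A - card I)"
    using fin(1) by simp
  finally show ?thesis .
qed


section \<open>Copies of a graph and cliques\<close>

text \<open>On both sides tail and head are \<open>fst\<close> and \<open>snd\<close>, so
  compatibility with the ends forces the arc map to be \<open>map_prod h h\<close> on the arcs; only
  the vertex bijection is left to choose.\<close>

lemma digraph_iso_with_proj_iff:
  "digraph_iso (with_proj S) (with_proj F) \<longleftrightarrow>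
     wf_digraph (with_proj S) \<and>
     (\<exists>h. bij_betw h (pverts S) (pverts F) \<and> parcs F = map_prod h h ` parcs S)"
proof
  assume "digraph_iso (with_proj S) (with_proj F)"
  then obtain f where iso: "pre_digraph.digraph_isomorphism (with_proj S) f"
    and F: "with_proj F = app_iso f (with_proj S)"
    by (auto simp: digraph_iso_def)
  have V: "pverts F = iso_verts f ` pverts S" and A: "parcs F = iso_arcs f ` parcs S"
    and ends: "iso_tail f = fst" "iso_head f = snd"
    using arg_cong[OF F, of verts] arg_cong[OF F, of arcs] arg_cong[OF F, of tail]
      arg_cong[OF F, of head] by simp_all
  have "iso_arcs f a = map_prod (iso_verts f) (iso_verts f) a" if "a \<in> parcs S" for a
    using iso that ends by (auto simp: pre_digraph.digraph_isomorphism_def prod_eq_iff)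
  then have "parcs F = map_prod (iso_verts f) (iso_verts f) ` parcs S"
    unfolding A by (rule image_cong[OF refl])
  then show "wf_digraph (with_proj S) \<and>
     (\<exists>h. bij_betw h (pverts S) (pverts F) \<and> parcs F = map_prod h h ` parcs S)"
    using iso V by (auto simp: pre_digraph.digraph_isomorphism_def bij_betw_def)
next
  assume "wf_digraph (with_proj S) \<and>
     (\<exists>h. bij_betw h (pverts S) (pverts F) \<and> parcs F = map_prod h h ` parcs S)"
  then obtain h where wf: "wf_digraph (with_proj S)" and h: "bij_betw h (pverts S) (pverts F)"
    and A: "parcs F = map_prod h h ` parcs S" by blast
  let ?f = "\<lparr>iso_verts = h, iso_arcs = map_prod h h, iso_head = snd, iso_tail = fst\<rparr>"
  have sub: "parcs S \<subseteq> pverts S \<times> pverts S"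
    using wf by (auto simp: wf_digraph_def)
  have "inj_on (map_prod h h) (parcs S)"
    using map_prod_inj_on[of h "pverts S" h "pverts S"] h sub
    by (auto simp: bij_betw_def intro: inj_on_subset)
  then have "pre_digraph.digraph_isomorphism (with_proj S) ?f"
    using wf h by (simp add: pre_digraph.digraph_isomorphism_def bij_betw_def)
  moreover have "with_proj F = app_iso ?f (with_proj S)"
    using h A by (simp add: app_iso_def with_proj_def bij_betw_def)
  ultimately show "digraph_iso (with_proj S) (with_proj F)"
    unfolding digraph_iso_def by blast
qed

lemma simple_graph_iff:
  "simple_graph G \<longleftrightarrow> finite (pverts G) \<and> pverts G \<noteq> {} \<and> parcs G \<subseteq> pverts G \<times> pverts G
     \<and> sym (parcs G) \<and> irrefl (parcs G)"
proof
  assume "simple_graph G"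
  then have G: "pair_graph G" and ne: "pverts G \<noteq> {}" by (auto simp: simple_graph_def)
  interpret pair_graph G by fact
  show "finite (pverts G) \<and> pverts G \<noteq> {} \<and> parcs G \<subseteq> pverts G \<times> pverts G
     \<and> sym (parcs G) \<and> irrefl (parcs G)"
    using pair_finite_verts ne in_arcsD1 in_arcsD2 pair_sym_arcs pair_no_loops
    by (fastforce simp: symmetric_def irrefl_def)
next
  assume G: "finite (pverts G) \<and> pverts G \<noteq> {} \<and> parcs G \<subseteq> pverts G \<times> pverts G
     \<and> sym (parcs G) \<and> irrefl (parcs G)"
  then have "finite (parcs G)" by (meson finite_SigmaI finite_subset)
  with G have "pair_graph G"
    by unfold_locales (auto simp: symmetric_def irrefl_def)
  then show "simple_graph G" using G by (simp add: simple_graph_def)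
qed

lemma subgraph_with_proj_iff:
  assumes "simple_graph S" "simple_graph H"
  shows "subgraph (with_proj S) (with_proj H) \<longleftrightarrow>
           pverts S \<subseteq> pverts H \<and> parcs S \<subseteq> parcs H"
  using assms by (auto simp: subgraph_def simple_graph_iff compatible_def wf_digraph_def)

text \<open>The copy is the image of \<open>F\<close> under \<open>h\<close>, with
  \<open>inv_into\<close> as isomorphism back to \<open>F\<close>. Its symmetry comes from
  \<open>F\<close>, its lack of loops from \<open>H\<close>.\<close>

lemma contains_subgraphI:
  assumes F: "simple_graph F" and H: "simple_graph H" and h: "inj_on h (pverts F)"
    and V: "h ` pverts F \<subseteq> pverts H" and A: "\<And>u v. (u, v) \<in> parcs F \<Longrightarrow> (h u, h v) \<in> parcs H"
  shows "contains_subgraph H F"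
proof -
  let ?S = "\<lparr>pverts = h ` pverts F, parcs = map_prod h h ` parcs F\<rparr>"
  let ?i = "inv_into (pverts F) h"
  note F' = F[unfolded simple_graph_iff] and H' = H[unfolded simple_graph_iff]
  have AH: "map_prod h h ` parcs F \<subseteq> parcs H" using A by auto
  have "irrefl (map_prod h h ` parcs F)" using AH H' by (auto simp: irrefl_def)
  moreover have "sym (map_prod h h ` parcs F)"
    using F' by (force simp: sym_def)
  ultimately have S: "simple_graph ?S"
    using F' by (auto simp: simple_graph_iff)
  have "map_prod ?i ?i ` map_prod h h ` parcs F = (\<lambda>a. a) ` parcs F"
    unfolding image_image using F' h by (intro image_cong) auto
  moreover have "bij_betw ?i (h ` pverts F) (pverts F)"
    using h by (simp add: bij_betw_inv_into inj_on_imp_bij_betw)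
  ultimately have "digraph_iso (with_proj ?S) (with_proj F)"
    using S by (auto simp: digraph_iso_with_proj_iff simple_graph_iff wf_digraph_def
        intro!: exI[of _ ?i])
  moreover have "subgraph (with_proj ?S) (with_proj H)"
    using V AH S H by (simp add: subgraph_with_proj_iff)
  ultimately show ?thesis
    using S by (auto simp: contains_subgraph_def copies_def)
qed

section \<open>Complete subgraphs as vertex sets, and their enumerations\<close>

definition cliques :: "nat \<Rightarrow> 'v pair_pre_digraph \<Rightarrow> 'v set set" where
  "cliques n H = {S. S \<subseteq> pverts H \<and> card S = n \<and> (\<forall>u\<in>S. \<forall>v\<in>S. u \<noteq> v \<longrightarrow> (u, v) \<in> parcs H)}"

text \<open>A copy of the complete graph has every arc between distinct vertices, so its vertex set
  determines it; conversely a clique carries all these arcs. Here \<open>n \<ge> 1\<close> supplies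
  the nonempty vertex set required by \<open>simple_graph\<close>.\<close>

lemma copies_complete_graph:
  assumes H: "simple_graph H" and n: "n \<ge> 1"
  shows "bij_betw pverts (copies (complete_graph n) H) (cliques n H)"
proof (rule bij_betw_byWitness[where f' = "\<lambda>S. \<lparr>pverts = S, parcs = S \<times> S - Id\<rparr>"])
  have copyD: "parcs S = pverts S \<times> pverts S - Id" "card (pverts S) = n"
    if S: "S \<in> copies (complete_graph n) H" for S
  proof -
    from S obtain h where S: "simple_graph S" and h: "bij_betw h (pverts S) {..<n}"
      and A: "{(i, j). i < n \<and> j < n \<and> i \<noteq> j} = map_prod h h ` parcs S"
      by (auto simp: copies_def digraph_iso_with_proj_iff complete_graph_def)
    note S' = S[unfolded simple_graph_iff]
    show "card (pverts S) = n" using bij_betw_same_card[OF h] by simp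
    have "(u, v) \<in> parcs S" if uv: "u \<in> pverts S" "v \<in> pverts S" "u \<noteq> v" for u v
    proof -
      \<comment> \<open>The arc between the images comes from some arc of \<open>S\<close>, whose
        ends injectivity of \<open>h\<close> identifies as \<open>u\<close> and
        \<open>v\<close>.\<close>
      have "(h u, h v) \<in> {(i, j). i < n \<and> j < n \<and> i \<noteq> j}"
        using h uv by (auto simp: bij_betw_def inj_on_def)
      then obtain u' v' where "(u', v') \<in> parcs S" "h u = h u'" "h v = h v'"
        unfolding A by auto
      moreover from this have "u' \<in> pverts S" "v' \<in> pverts S" using S' by auto
      ultimately show ?thesis using h uv by (metis bij_betw_def inj_onD)
    qed
    then show "parcs S = pverts S \<times> pverts S - Id"
      using S' by (auto simp: irrefl_def)
  qed
  then show "\<forall>S\<in>copies (complete_graph n) H.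
      \<lparr>pverts = pverts S, parcs = pverts S \<times> pverts S - Id\<rparr> = S"
    by simp
  show "\<forall>S\<in>cliques n H. pverts \<lparr>pverts = S, parcs = S \<times> S - Id\<rparr> = S" by simp
  show "pverts ` copies (complete_graph n) H \<subseteq> cliques n H"
  proof clarify
    fix S assume S: "S \<in> copies (complete_graph n) H"
    then have "pverts S \<subseteq> pverts H \<and> parcs S \<subseteq> parcs H"
      using H by (auto simp: copies_def subgraph_with_proj_iff)
    then show "pverts S \<in> cliques n H"
      using copyD[OF S] by (auto simp: cliques_def)
  qed
  show "(\<lambda>S. \<lparr>pverts = S, parcs = S \<times> S - Id\<rparr>) ` cliques n H \<subseteq> copies (complete_graph n) H"
  proof clarify
    fix S assume S: "S \<in> cliques n H"
    let ?S = "\<lparr>pverts = S, parcs = S \<times> S - Id\<rparr>"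
    have fin: "finite S" and "card S = n"
      using S H n by (auto simp: cliques_def simple_graph_iff intro: finite_subset)
    then obtain h where h: "bij_betw h S {..<n}"
      using finite_same_card_bij[of S "{..<n}"] by auto
    have S': "simple_graph ?S"
      using fin \<open>card S = n\<close> n by (auto simp: simple_graph_iff sym_def irrefl_def)
    have "{(i, j). i < n \<and> j < n \<and> i \<noteq> j} = map_prod h h ` (S \<times> S - Id)"
    proof -
      have "map_prod h h ` (S \<times> S - Id) = h ` S \<times> h ` S - Id"
      proof
        show "map_prod h h ` (S \<times> S - Id) \<subseteq> h ` S \<times> h ` S - Id"
          using h by (auto simp: bij_betw_def dest: inj_onD)
        show "h ` S \<times> h ` S - Id \<subseteq> map_prod h h ` (S \<times> S - Id)"
          by auto
      qed
      then show ?thesis using h by (auto simp: bij_betw_def)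
    qed
    then have "digraph_iso (with_proj ?S) (with_proj (complete_graph n))"
      using h by (auto simp: digraph_iso_with_proj_iff complete_graph_def wf_digraph_def
          intro!: exI[of _ h])
    moreover have "subgraph (with_proj ?S) (with_proj H)"
      using S S' H by (auto simp: subgraph_with_proj_iff cliques_def)
    ultimately show "?S \<in> copies (complete_graph n) H"
      using S' by (simp add: copies_def)
  qed
qed

definition clique_embeddings :: "nat \<Rightarrow> 'v pair_pre_digraph \<Rightarrow> (nat \<Rightarrow> 'v) set" where
  "clique_embeddings n H =
     {g \<in> {..<n} \<rightarrow>\<^sub>E pverts H. inj_on g {..<n} \<and>
        (\<forall>i<n. \<forall>j<n. i \<noteq> j \<longrightarrow> (g i, g j) \<in> parcs H)}"

text \<open>Embeddings are sorted by their image. Each clique is the image of \<open>fact n\<close>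
  of them, and different cliques give disjoint sets.\<close>

lemma card_clique_embeddings:
  assumes H: "simple_graph H" and n: "n \<ge> 1"
  shows "card (clique_embeddings n H) = card (copies (complete_graph n) H) * fact n"
proof -
  have finH: "finite (pverts H)" using H by (simp add: simple_graph_iff)
  have fincl: "finite (cliques n H)"
    by (rule finite_subset[of _ "Pow (pverts H)"]) (auto simp: cliques_def finH)
  have clD: "finite S" "card S = n" if "S \<in> cliques n H" for S
    using that finH by (auto simp: cliques_def intro: finite_subset)
  let ?B = "\<lambda>S. {h \<in> extensional {..<n}. bij_betw h {..<n} S}"
  have "clique_embeddings n H = (\<Union>S\<in>cliques n H. ?B S)"
  proof (intro set_eqI iffI)
    fix g assume g: "g \<in> clique_embeddings n H"
    then have "g ` {..<n} \<in> cliques n H"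
      by (auto simp: clique_embeddings_def cliques_def card_image)
    moreover have "g \<in> ?B (g ` {..<n})"
      using g by (auto simp: clique_embeddings_def bij_betw_def PiE_def)
    ultimately show "g \<in> (\<Union>S\<in>cliques n H. ?B S)" by blast
  next
    fix g assume "g \<in> (\<Union>S\<in>cliques n H. ?B S)"
    then obtain S where S: "S \<in> cliques n H" and g: "g \<in> extensional {..<n}" "bij_betw g {..<n} S"
      by blast
    have "g i \<in> S" if "i < n" for i using g(2) that by (auto simp: bij_betw_def)
    then show "g \<in> clique_embeddings n H"
      using S g by (fastforce simp: clique_embeddings_def cliques_def bij_betw_def PiE_def inj_on_def)
  qed
  also have "card \<dots> = (\<Sum>S\<in>cliques n H. card (?B S))"
  proof (rule card_UN_disjoint[OF fincl])
    show "\<forall>S\<in>cliques n H. finite (?B S)"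
      using finite_bijections_over[of "{..<n}" _ "\<lambda>_. True" "\<lambda>_. True"] clD(1)
      by (auto simp: bijections_over_def)
  qed (auto simp: bij_betw_def)
  also have "\<dots> = card (cliques n H) * fact n"
    using clD by (simp add: card_bij_betw_extensional)
  finally show ?thesis
    using bij_betw_same_card[OF copies_complete_graph[OF assms]] by simp
qed

section \<open>Colorings of complete multipartite graphs\<close>

lemma pverts_complete_multipartite [simp]:
  "(i, j) \<in> pverts (complete_multipartite \<nu>) \<longleftrightarrow> i < length \<nu> \<and> j < \<nu> ! i"
  by (simp add: complete_multipartite_def)

lemma parcs_complete_multipartite [simp]:
  "((i, j), (i', j')) \<in> parcs (complete_multipartite \<nu>) \<longleftrightarrow>
     i < length \<nu> \<and> j < \<nu> ! i \<and> i' < length \<nu> \<and> j' < \<nu> ! i' \<and> i \<noteq> i'"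
  by (simp add: complete_multipartite_def)

lemma finite_pverts_complete_multipartite [simp]: "finite (pverts (complete_multipartite \<nu>))"
proof -
  have "pverts (complete_multipartite \<nu>) = (SIGMA i:{..<length \<nu>}. {..<\<nu> ! i})"
    by auto
  then show ?thesis by simp
qed

text \<open>Restriction to the vertices makes this an extensional function, as members of
  \<open>proper_colorings\<close> are.\<close>

definition part_coloring :: "nat list \<Rightarrow> (nat \<Rightarrow> nat) \<Rightarrow> nat \<times> nat \<Rightarrow> nat" where
  "part_coloring \<nu> c = restrict (\<lambda>(i, j). c i) (pverts (complete_multipartite \<nu>))"

lemma part_coloring_apply [simp]:
  "i < length \<nu> \<Longrightarrow> j < \<nu> ! i \<Longrightarrow> part_coloring \<nu> c (i, j) = c i"
  by (simp add: part_coloring_def)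

text \<open>Distinct parts get distinct colours, so each colour class is a single part and each
  exponent is the size of a part.\<close>

lemma lookup_part_coloring_monom:
  fixes \<nu> c
  defines "\<alpha> \<equiv> coloring_monom (complete_multipartite \<nu>) (part_coloring \<nu> c)"
  assumes c: "inj_on c {..<length \<nu>}"
  shows "i < length \<nu> \<Longrightarrow> Poly_Mapping.lookup \<alpha> (c i) = \<nu> ! i"
    and "x \<notin> c ` {..<length \<nu>} \<Longrightarrow> Poly_Mapping.lookup \<alpha> x = 0"
proof -
  assume i: "i < length \<nu>"
  have "{v \<in> pverts (complete_multipartite \<nu>). part_coloring \<nu> c v = c i} = {i} \<times> {..<\<nu> ! i}"
    using c i by (auto dest: inj_onD)
  then show "Poly_Mapping.lookup \<alpha> (c i) = \<nu> ! i"
    by (simp add: \<alpha>_def lookup_coloring_monom card_cartesian_product)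
next
  assume "x \<notin> c ` {..<length \<nu>}"
  then have "{v \<in> pverts (complete_multipartite \<nu>). part_coloring \<nu> c v = x} = {}"
    by auto
  then show "Poly_Mapping.lookup \<alpha> x = 0"
    by (simp add: \<alpha>_def lookup_coloring_monom)
qed

lemma simple_graph_complete_graph_minus:
  "n \<ge> 1 \<Longrightarrow> simple_graph (complete_graph_minus n)"
  by (auto simp: simple_graph_iff complete_graph_minus_def complete_graph_def sym_def irrefl_def
      lessThan_empty_iff)

text \<open>
  Two colours on one part, together with one colour from each of the other parts, would span a
  copy of \<open>K\<^bsub>n+1\<^esub>\<close> minus an edge.
\<close>

lemma coloring_constant_on_parts:
  assumes H: "simple_graph H" and free: "\<not> contains_subgraph H (complete_graph_minus (length \<nu> + 1))"
    and pos: "0 \<notin> set \<nu>"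
    and hom: "\<And>u v. (u, v) \<in> parcs (complete_multipartite \<nu>) \<Longrightarrow> (f u, f v) \<in> parcs H"
    and V: "\<And>v. v \<in> pverts (complete_multipartite \<nu>) \<Longrightarrow> f v \<in> pverts H"
    and i: "i < length \<nu>" "j < \<nu> ! i" "j' < \<nu> ! i"
  shows "f (i, j) = f (i, j')"
proof (rule ccontr)
  assume neq: "f (i, j) \<noteq> f (i, j')"
  let ?n = "length \<nu>"
  have nz: "0 < \<nu> ! t" if "t < ?n" for t
    using pos nth_mem[OF that] by (metis gr0I)
  have loop: "u \<noteq> v" if "(u, v) \<in> parcs H" for u v
    using that H by (auto simp: simple_graph_iff irrefl_def)
  \<comment> \<open>\<open>\<sigma>\<close> numbers the parts other than \<open>i\<close> by
    \<open>2, ..., n\<close>; the indices 0 and 1, joined by the deleted edge, are kept for the two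
    vertices of part \<open>i\<close>.\<close>
  have "card {2..?n} = card ({..<?n} - {i})" using i by simp
  then obtain \<sigma> where \<sigma>: "bij_betw \<sigma> {2..?n} ({..<?n} - {i})"
    using finite_same_card_bij[of "{2..?n}" "{..<?n} - {i}"] by auto
  have \<sigma>r: "\<sigma> t < ?n" "\<sigma> t \<noteq> i" if "2 \<le> t" "t \<le> ?n" for t
    using bij_betwE[OF \<sigma>] that by auto
  have \<sigma>i: "\<sigma> s \<noteq> \<sigma> t" if "2 \<le> s" "s \<le> ?n" "2 \<le> t" "t \<le> ?n" "s \<noteq> t" for s t
    using \<sigma> that by (auto simp: bij_betw_def inj_on_def)
  define p where "p t = (if t = 0 then (i, j) else if t = 1 then (i, j') else (\<sigma> t, 0))" for t :: nat
  have pV: "p t \<in> pverts (complete_multipartite \<nu>)" if "t \<le> ?n" for t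
    using i that \<sigma>r[of t] nz by (auto simp: p_def)
  \<comment> \<open>Apart from the pair 0, 1, distinct indices go to different parts, and
    \<open>f\<close> preserves the resulting arcs.\<close>
  have arc: "(f (p s), f (p t)) \<in> parcs H"
    if st: "s \<le> ?n" "t \<le> ?n" "s \<noteq> t" "\<not> (s < 2 \<and> t < 2)" for s t
  proof (rule hom)
    have "fst (p s) \<noteq> fst (p t)"
      using st \<sigma>r[of s] \<sigma>r[of t] \<sigma>i[of s t] by (auto simp: p_def)
    then show "(p s, p t) \<in> parcs (complete_multipartite \<nu>)"
      using pV[OF st(1)] pV[OF st(2)] by (cases "p s"; cases "p t") auto
  qed
  have "contains_subgraph H (complete_graph_minus (?n + 1))"
  proof (rule contains_subgraphI[where h = "f \<circ> p"])
    show "inj_on (f \<circ> p) (pverts (complete_graph_minus (?n + 1)))"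
    proof (rule inj_onI, rule ccontr)
      fix s t
      assume "s \<in> pverts (complete_graph_minus (?n + 1))" "t \<in> pverts (complete_graph_minus (?n + 1))"
        and eq: "(f \<circ> p) s = (f \<circ> p) t" and "s \<noteq> t"
      then have st: "s \<le> ?n" "t \<le> ?n" by (auto simp: complete_graph_minus_def)
      \<comment> \<open>The pair 0, 1 is separated by \<open>neq\<close>; every other pair has
        adjacent images, which differ because \<open>H\<close> has no loops.\<close>
      show False
      proof (cases "s < 2 \<and> t < 2")
        case True
        then have "s = 0 \<and> t = 1 \<or> s = 1 \<and> t = 0" using \<open>s \<noteq> t\<close> by auto
        then show False using eq neq by (auto simp: p_def)
      next
        case False
        then show False using loop[OF arc[OF st \<open>s \<noteq> t\<close>]] eq by simp
      qed
    qed
    show "(f \<circ> p) ` pverts (complete_graph_minus (?n + 1)) \<subseteq> pverts H"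
      using V[OF pV] by (auto simp: complete_graph_minus_def)
    fix s t assume "(s, t) \<in> parcs (complete_graph_minus (?n + 1))"
    then have "s \<le> ?n" "t \<le> ?n" "s \<noteq> t" "\<not> (s < 2 \<and> t < 2)"
      by (auto simp: complete_graph_minus_def complete_graph_def less_2_cases_iff)
    then show "((f \<circ> p) s, (f \<circ> p) t) \<in> parcs H" using arc by simp
  qed (use H in \<open>simp_all add: simple_graph_complete_graph_minus\<close>)
  with free show False by simp
qed

section \<open>Colored labelings as triples, and their number\<close>

text \<open>As \<open>\<phi>\<close> is injective, \<open>\<phi> (g i) = c i\<close> makes
  \<open>g\<close> redundant as data. Keeping it in the triple lets the choices be made in the order
  \<open>c\<close>, \<open>g\<close>, \<open>\<phi>\<close>, each with a number of options that does
  not depend on the earlier ones.\<close>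

lemma colored_labelings_complete_multipartite:
  fixes \<nu> and H :: "'v pair_pre_digraph" and \<alpha>
  defines "n \<equiv> length \<nu>"
  assumes H: "simple_graph H" and free: "\<not> contains_subgraph H (complete_graph_minus (n + 1))"
    and pos: "0 \<notin> set \<nu>"
  shows "bij_betw (\<lambda>(c, g, \<phi>). (\<phi>, part_coloring \<nu> c))
           (SIGMA c:bijections_over {..<n} ((!) \<nu>) (Poly_Mapping.keys \<alpha>) (Poly_Mapping.lookup \<alpha>).
              SIGMA g:clique_embeddings n H.
                {\<phi> \<in> extensional (pverts H). bij_betw \<phi> (pverts H) {..<card (pverts H)} \<and>
                   (\<forall>i\<in>{..<n}. \<phi> (g i) = c i)})
           (colored_labelings (complete_multipartite \<nu>) H \<alpha>)"
    (is "bij_betw ?F ?S ?T")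
proof (rule bij_betw_imageI)
  let ?V = "pverts H" and ?N = "card (pverts H)" and ?G = "complete_multipartite \<nu>"
  \<comment> \<open>Every part has the vertex \<open>(t, 0)\<close>, from which its colour is read
    off.\<close>
  have nz: "0 < \<nu> ! t" if "t < n" for t
    using pos nth_mem[of t \<nu>] that unfolding n_def by (metis gr0I)
  have SD: "bij_betw c {..<n} (Poly_Mapping.keys \<alpha>)" "c \<in> extensional {..<n}"
    "\<And>i. i < n \<Longrightarrow> Poly_Mapping.lookup \<alpha> (c i) = \<nu> ! i"
    "g \<in> extensional {..<n}" "\<And>i. i < n \<Longrightarrow> g i \<in> ?V"
    "\<And>i j. i < n \<Longrightarrow> j < n \<Longrightarrow> i \<noteq> j \<Longrightarrow> (g i, g j) \<in> parcs H"
    "\<phi> \<in> extensional ?V" "bij_betw \<phi> ?V {..<?N}" "\<And>i. i < n \<Longrightarrow> \<phi> (g i) = c i"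
    if "(c, g, \<phi>) \<in> ?S" for c g \<phi>
    using that by (auto simp: bijections_over_def clique_embeddings_def PiE_iff)
  show "inj_on ?F ?S"
  proof (rule inj_onI)
    fix q q' assume "q \<in> ?S" "q' \<in> ?S" "?F q = ?F q'"
    moreover obtain c g \<phi> c' g' \<phi>' where q: "q = (c, g, \<phi>)" "q' = (c', g', \<phi>')"
      by (metis prod_cases3)
    ultimately have "(c, g, \<phi>) \<in> ?S" "(c', g', \<phi>') \<in> ?S" and \<phi>: "\<phi> = \<phi>'"
      and eq: "part_coloring \<nu> c = part_coloring \<nu> c'"
      by simp_all
    note S = SD[OF this(1)] and S' = SD[OF this(2), folded \<phi>]
    have cc: "c i = c' i" if "i < n" for i
      using fun_cong[OF eq, of "(i, 0)"] nz[OF that] that by (simp add: n_def)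
    then have "c = c'" using S(2) S'(2) by (auto intro: extensionalityI)
    moreover have "g i = g' i" if i: "i < n" for i
    proof (rule inj_onD[OF bij_betw_imp_inj_on[OF S(8)]])
      show "\<phi> (g i) = \<phi> (g' i)" using S(9) S'(9) cc i by simp
    qed (use S(5) S'(5) i in auto)
    then have "g = g'" using S(4) S'(4) by (auto intro: extensionalityI)
    ultimately show "q = q'" by (simp add: q \<phi>)
  qed
  show "?F ` ?S = ?T"
  proof (intro equalityI subsetI)
    fix q assume "q \<in> ?F ` ?S"
    then obtain c g \<phi> where q: "q = (\<phi>, part_coloring \<nu> c)" and "(c, g, \<phi>) \<in> ?S" by auto
    note S = SD[OF this(2)]
    have cN: "c i < ?N" if "i < n" for i
      using S(5,8,9) that by (metis bij_betwE lessThan_iff)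
    \<comment> \<open>Pulled back to \<open>H\<close>, the coloring sends part \<open>i\<close> to
      \<open>g i\<close>, so properness is adjacency of the clique vertices.\<close>
    have inv: "inv_into ?V \<phi> (c i) = g i" if "i < n" for i
      using S(5,8,9) that by (metis bij_betw_imp_inj_on inv_into_f_f)
    have "part_coloring \<nu> c \<in> proper_colorings ?G H \<phi>"
      using cN inv S(6) by (auto simp: proper_colorings_def part_coloring_def n_def)
    moreover have "coloring_monom ?G (part_coloring \<nu> c) = \<alpha>"
    proof (rule poly_mapping_eqI)
      fix x
      have c: "inj_on c {..<length \<nu>}" "c ` {..<length \<nu>} = Poly_Mapping.keys \<alpha>"
        using S(1) by (auto simp: bij_betw_def n_def)
      show "Poly_Mapping.lookup (coloring_monom ?G (part_coloring \<nu> c)) x = Poly_Mapping.lookup \<alpha> x"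
      proof (cases "x \<in> c ` {..<length \<nu>}")
        case True
        then show ?thesis
          using lookup_part_coloring_monom(1)[OF c(1)] S(3) by (auto simp: n_def)
      next
        case False
        then show ?thesis
          using lookup_part_coloring_monom(2)[OF c(1) False] c(2) by (simp add: in_keys_iff)
      qed
    qed
    ultimately show "q \<in> ?T"
      using S(7,8) by (simp add: q colored_labelings_def labelings_def)
  next
    fix q assume "q \<in> ?T"
    then obtain \<phi> \<kappa> where q: "q = (\<phi>, \<kappa>)" and \<phi>: "\<phi> \<in> extensional ?V" "bij_betw \<phi> ?V {..<?N}"
      and ran: "\<kappa> \<in> pverts ?G \<rightarrow>\<^sub>E {..<?N}" and mon: "coloring_monom ?G \<kappa> = \<alpha>"
      and hom: "\<And>u v. (u, v) \<in> parcs ?G \<Longrightarrow> (inv_into ?V \<phi> (\<kappa> u), inv_into ?V \<phi> (\<kappa> v)) \<in> parcs H"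
      unfolding colored_labelings_def labelings_def proper_colorings_def by blast
    \<comment> \<open>\<open>f\<close> is the coloring read in \<open>H\<close>: a graph
      homomorphism, to which \<open>coloring_constant_on_parts\<close> applies.\<close>
    define f where "f v = inv_into ?V \<phi> (\<kappa> v)" for v
    have fV: "f v \<in> ?V" and \<phi>f: "\<phi> (f v) = \<kappa> v" if "v \<in> pverts ?G" for v
    proof -
      have "\<kappa> v \<in> \<phi> ` ?V" using ran \<phi>(2) that by (auto simp: bij_betw_def)
      then show "f v \<in> ?V" "\<phi> (f v) = \<kappa> v"
        unfolding f_def by (auto intro: inv_into_into f_inv_into_f)
    qed
    define c where "c = restrict (\<lambda>i. \<kappa> (i, 0)) {..<n}"
    define g where "g = restrict (\<lambda>i. f (i, 0)) {..<n}"
    have arc: "(g i, g j) \<in> parcs H" if "i < n" "j < n" "i \<noteq> j" for i j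
      using hom[of "(i, 0)" "(j, 0)"] nz that by (simp add: g_def f_def n_def)
    have gV: "g i \<in> ?V" and \<phi>g: "\<phi> (g i) = c i" if "i < n" for i
      using fV[of "(i, 0)"] \<phi>f[of "(i, 0)"] nz[OF that] that by (auto simp: g_def c_def n_def)
    have ginj: "inj_on g {..<n}"
    proof (rule inj_onI, rule ccontr)
      fix i j assume "i \<in> {..<n}" "j \<in> {..<n}" "g i = g j" "i \<noteq> j"
      then have "(g i, g i) \<in> parcs H" using arc[of i j] by simp
      then show False using H by (auto simp: simple_graph_iff irrefl_def)
    qed
    have cinj: "inj_on c {..<n}"
    proof (rule inj_onI)
      fix i j assume ij: "i \<in> {..<n}" "j \<in> {..<n}" "c i = c j"
      then have "g i = g j"
        using bij_betw_imp_inj_on[OF \<phi>(2)] gV \<phi>g by (metis inj_onD lessThan_iff)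
      then show "i = j" using ginj ij by (auto dest: inj_onD)
    qed
    have \<kappa>: "\<kappa> = part_coloring \<nu> c"
    proof (rule extensionalityI[where A = "pverts ?G"])
      fix v assume v: "v \<in> pverts ?G"
      obtain i j where ij: "v = (i, j)" "i < n" "j < \<nu> ! i" using v by (cases v) (auto simp: n_def)
      have "f (i, j) = f (i, 0)"
        using coloring_constant_on_parts[OF H _ pos, of f i j 0] free hom fV ij nz[of i]
        by (simp add: f_def n_def)
      then have "\<kappa> (i, j) = \<kappa> (i, 0)"
        using \<phi>f[of "(i, j)"] \<phi>f[of "(i, 0)"] ij nz[of i] by (simp add: n_def)
      then show "\<kappa> v = part_coloring \<nu> c v" using ij by (simp add: c_def n_def)
    qed (use ran in \<open>auto simp: part_coloring_def PiE_iff\<close>)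
    \<comment> \<open>The exponents of \<open>\<alpha>\<close> are the part sizes at the colours
      \<open>c i\<close> and 0 elsewhere; since the sizes are positive, the keys are exactly these
      colours.\<close>
    note l = lookup_part_coloring_monom[OF cinj[unfolded n_def], folded \<kappa>, unfolded mon, folded n_def]
    have "Poly_Mapping.keys \<alpha> = c ` {..<n}"
      using l nz by (fastforce simp: in_keys_iff)
    then have "c \<in> bijections_over {..<n} ((!) \<nu>) (Poly_Mapping.keys \<alpha>) (Poly_Mapping.lookup \<alpha>)"
      using l(1) cinj by (auto simp: bijections_over_def bij_betw_def c_def)
    moreover have "g \<in> clique_embeddings n H"
      using arc ginj gV by (auto simp: clique_embeddings_def PiE_def g_def)
    ultimately show "q \<in> ?F ` ?S"
      using \<phi> \<phi>g by (auto simp: q \<kappa> intro!: image_eqI[of _ _ "(c, g, \<phi>)"])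
  qed
qed

lemma image_mset_nth: "image_mset ((!) xs) (mset_set {..<length xs}) = mset xs"
proof -
  have "image_mset ((!) xs) (mset_set {..<length xs}) = mset (map ((!) xs) [0..<length xs])"
    by (simp add: atLeast0LessThan)
  then show ?thesis by (simp only: map_nth)
qed

lemma set_partition_subset:
  assumes "\<nu> \<turnstile>p k"
  shows "set \<nu> \<subseteq> {1..k}"
proof
  fix x assume x: "x \<in> set \<nu>"
  then have "x \<noteq> 0" using assms by (metis is_partition_def)
  then show "x \<in> {1..k}"
    using x assms member_le_sum_list[of x \<nu>] by (auto simp: is_partition_def)
qed

text \<open>For the choice of \<open>c\<close>, the multiset hypothesis of
  \<open>card_bijections_over\<close> is exactly \<open>exp_mset \<alpha> = mset \<nu>\<close>, and
  the fibre over \<open>j\<close> has \<open>count_list \<nu> j\<close> elements.\<close>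

lemma card_colored_labelings_complete_multipartite:
  assumes k: "k \<ge> 1" and \<nu>: "\<nu> \<turnstile>p k" and n: "n = length \<nu>"
    and H: "simple_graph H" and N: "N = card (pverts H)"
    and free: "\<not> contains_subgraph H (complete_graph_minus (n + 1))"
  shows "card (colored_labelings (complete_multipartite \<nu>) H \<alpha>) =
    (if Poly_Mapping.keys \<alpha> \<subseteq> {..<N} \<and> exp_mset \<alpha> = mset \<nu>
     then card (copies (complete_graph n) H) * fact n
            * ((\<Prod>j=1..k. fact (count_list \<nu> j)) * fact (N - n))
     else 0)"
proof -
  let ?T = "colored_labelings (complete_multipartite \<nu>) H \<alpha>"
  let ?C = "bijections_over {..<n} ((!) \<nu>) (Poly_Mapping.keys \<alpha>) (Poly_Mapping.lookup \<alpha>)"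
  let ?X = "\<lambda>g c. {\<phi> \<in> extensional (pverts H). bij_betw \<phi> (pverts H) {..<card (pverts H)} \<and>
                   (\<forall>i\<in>{..<n}. \<phi> (g i) = c i)}"
  have pos: "0 \<notin> set \<nu>" using \<nu> by (simp add: is_partition_def)
  have n1: "n \<ge> 1" using k \<nu> by (cases \<nu>) (auto simp: is_partition_def n)
  have finH: "finite (pverts H)" using H by (simp add: simple_graph_iff)
  note bij = colored_labelings_complete_multipartite[OF H _ pos, of \<alpha>, folded n, OF free]
  show ?thesis
  proof (cases "Poly_Mapping.keys \<alpha> \<subseteq> {..<N} \<and> exp_mset \<alpha> = mset \<nu>")
    case True
    have finC: "finite ?C" by (simp add: finite_bijections_over)
    have finE: "finite (clique_embeddings n H)"
      by (rule finite_subset[OF _ finite_PiE[of "{..<n}" "\<lambda>_. pverts H"]])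
         (auto simp: clique_embeddings_def finH)
    have finX: "finite (?X g c)" for g c
      by (rule finite_subset[OF _ finite_labelings[OF finH]]) (auto simp: labelings_def)
    have X: "card (?X g c) = fact (N - n)" if "c \<in> ?C" "g \<in> clique_embeddings n H" for c g
    proof -
      have "inj_on c {..<n}" "c ` {..<n} \<subseteq> {..<card (pverts H)}"
        using that(1) True by (auto simp: bijections_over_def bij_betw_def N)
      moreover have "inj_on g {..<n}" "g ` {..<n} \<subseteq> pverts H"
        using that(2) by (auto simp: clique_embeddings_def)
      ultimately show ?thesis
        using card_bij_betw_extending[OF finH, of "{..<card (pverts H)}" g "{..<n}" c] N by simp
    qed
    have "(!) \<nu> ` {..<n} \<subseteq> {1..k}"
      using set_partition_subset[OF \<nu>] nth_mem[of _ \<nu>] by (auto simp: n)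
    then have C: "card ?C = (\<Prod>j=1..k. fact (count_list \<nu> j))"
      using card_bijections_over[of "{..<n}" "Poly_Mapping.keys \<alpha>" "{1..k}" "(!) \<nu>" "Poly_Mapping.lookup \<alpha>"]
        True by (simp add: n image_mset_nth exp_mset_def count_mset)
    have "card ?T = (\<Sum>c\<in>?C. \<Sum>g\<in>clique_embeddings n H. card (?X g c))"
      using finC finE finX by (simp add: bij_betw_same_card[OF bij, symmetric] card_SigmaI)
    also have "\<dots> = (\<Sum>c\<in>?C. \<Sum>g\<in>clique_embeddings n H. fact (N - n))"
      using X by (intro sum.cong) auto
    also have "\<dots> = card ?C * (card (clique_embeddings n H) * fact (N - n))"
      by simp
    finally show ?thesis
      using True by (simp add: C card_clique_embeddings[OF H n1])
  next
    case False
    \<comment> \<open>Any colored labeling would provide a \<open>c\<close> matching the parts of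
      \<open>\<nu>\<close> with the exponents of \<open>\<alpha>\<close>, forcing the excluded
      equality of multisets.\<close>
    have "?T = {}"
    proof (rule ccontr)
      assume "?T \<noteq> {}"
      then have keys: "Poly_Mapping.keys \<alpha> \<subseteq> {..<N}"
        using colored_labelings_nonempty(1) N by (metis finite_pverts_complete_multipartite)
      from \<open>?T \<noteq> {}\<close> obtain c where "c \<in> ?C"
        using bij_betw_imp_surj_on[OF bij] by blast
      then have c: "inj_on c {..<n}" "Poly_Mapping.keys \<alpha> = c ` {..<n}"
        "\<And>i. i < n \<Longrightarrow> Poly_Mapping.lookup \<alpha> (c i) = \<nu> ! i"
        by (auto simp: bijections_over_def bij_betw_def)
      have "exp_mset \<alpha> = image_mset (\<lambda>i. Poly_Mapping.lookup \<alpha> (c i)) (mset_set {..<n})"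
        using c(1) by (simp add: exp_mset_def c(2) image_mset_mset_set[symmetric] multiset.map_comp comp_def)
      also have "\<dots> = mset \<nu>"
        unfolding image_mset_nth[symmetric] n[symmetric] using c(3) by (intro image_mset_cong) auto
      finally show False using False keys by simp
    qed
    then show ?thesis using False by auto
  qed
qed

section \<open>From monomial counts to the symmetric function\<close>

text \<open>The count is constant on monomials of type \<open>\<nu>\<close> and vanishes on all
  others, so a coefficient family supported at \<open>\<nu>\<close> works, and by uniqueness it is
  \<open>hchrom_coeff\<close>.\<close>

lemma hchrom_symfun_complete_multipartite:
  assumes k: "k \<ge> 1" and \<nu>: "\<nu> \<turnstile>p k" and n: "n = length \<nu>"
    and H: "simple_graph H" and N: "N = card (pverts H)"
    and free: "\<not> contains_subgraph H (complete_graph_minus (n + 1))"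
  shows "(hchrom_symfun (complete_multipartite \<nu>) H :: 'a :: comm_ring_1 symfun)
           = of_nat (card (copies (complete_graph n) H) * fact n) \<cdot>\<^sub>s msym_aug N \<nu>"
proof -
  let ?G = "complete_multipartite \<nu>"
  let ?a = "card (copies (complete_graph n) H) * fact n"
  let ?b = "(\<Prod>j=1..k. fact (count_list \<nu> j)) * fact (N - n)"
  let ?P = "partitions_le k N"
  note G = complete_multipartite_graph[OF \<nu> k]
  have finH: "finite (pverts H)" using H by (simp add: simple_graph_iff)
  have inP: "\<nu> \<in> ?P \<longleftrightarrow> n \<le> N" using \<nu> by (simp add: partitions_le_def n)
  \<comment> \<open>If \<open>n > N\<close>, then \<open>\<nu>\<close> is not in
    \<open>partitions_le k N\<close>, where \<open>is_hchrom_coeff\<close> demands the value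
    0.\<close>
  define c :: "nat list \<Rightarrow> 'a" where
    "c \<mu> = (if \<mu> = \<nu> \<and> n \<le> N then of_nat (?a * ?b) else 0)" for \<mu>
  have "is_hchrom_coeff ?G H c"
    unfolding is_hchrom_coeff_def Let_def G(2) N[symmetric]
  proof (intro conjI allI impI poly_mapping_eqI)
    fix \<mu> assume "\<mu> \<notin> ?P" then show "c \<mu> = 0" using inP by (auto simp: c_def)
  next
    fix \<alpha>
    \<comment> \<open>A monomial of type \<open>\<nu>\<close> uses \<open>n\<close> distinct
      variables, so none exists when \<open>n > N\<close>.\<close>
    have "n \<le> N" if "Poly_Mapping.keys \<alpha> \<subseteq> {..<N}" "exp_mset \<alpha> = mset \<nu>"
      using card_mono[OF _ that(1)] arg_cong[OF that(2), of size]
      by (simp add: exp_mset_def n)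
    then have "Poly_Mapping.lookup (hchrom_poly ?G H :: _ \<Rightarrow>\<^sub>0 'a) \<alpha>
        = (if Poly_Mapping.keys \<alpha> \<subseteq> {..<N} \<and> exp_mset \<alpha> = mset \<nu> then c \<nu> else 0)"
      unfolding lookup_hchrom_poly[OF finite_pverts_complete_multipartite finH]
        card_colored_labelings_complete_multipartite[OF assms] c_def by simp
    also have "\<dots> = (\<Sum>\<mu>\<in>?P. if \<mu> = \<nu> then
        (if Poly_Mapping.keys \<alpha> \<subseteq> {..<N} \<and> exp_mset \<alpha> = mset \<nu> then c \<nu> else 0) else 0)"
      using inP by (simp add: finite_partitions_le c_def)
    also have "\<dots> = Poly_Mapping.lookup (\<Sum>\<mu>\<in>?P. Poly_Mapping.single 0 (c \<mu>) * msym_poly N \<mu>) \<alpha>"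
      unfolding lookup_sum lookup_scaled_msym_poly
      by (intro sum.cong) (auto simp: c_def)
    finally show "Poly_Mapping.lookup (hchrom_poly ?G H) \<alpha>
        = Poly_Mapping.lookup (\<Sum>\<mu>\<in>?P. Poly_Mapping.single 0 (c \<mu>) * msym_poly N \<mu>) \<alpha>" .
  qed
  then have "hchrom_coeff ?G H = c"
    unfolding hchrom_coeff_def by (rule the1_equality[OF hchrom_coeff_ex1[OF G(1) H]])
  then have "(hchrom_symfun ?G H :: 'a symfun) = (\<Sum>\<mu>\<in>?P. c \<mu> \<cdot>\<^sub>s msym \<mu>)"
    by (simp add: hchrom_symfun_def G(2) N)
  also have "\<dots> = (\<Sum>\<mu>\<in>?P. if \<mu> = \<nu> then of_nat (?a * ?b) \<cdot>\<^sub>s msym \<nu> else 0)"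
    using inP by (intro sum.cong) (auto simp: c_def)
  also have "\<dots> = of_nat ?a \<cdot>\<^sub>s msym_aug N \<nu>"
    using inP \<nu> by (simp add: finite_partitions_le msym_aug_def n is_partition_def)
  finally show ?thesis .
qed

theorem proposition7p1:
  fixes \<nu> :: "nat list" and k n m N :: nat and H :: "'v pair_pre_digraph"
  assumes "k \<ge> 1" and "\<nu> \<turnstile>p k" and "n = length \<nu>"
    and "simple_graph H" and "N = card (pverts H)"
    and "\<not> contains_subgraph H (complete_graph_minus (n + 1))"
    and "m = card (copies (complete_graph n) H)"
  shows "(hchrom_symfun (complete_multipartite \<nu>) H :: 'a :: comm_ring_1 symfun)
           = of_nat (m * fact n) \<cdot>\<^sub>s msym_aug N \<nu>
       \<and> (of_nat (m * fact n) \<cdot>\<^sub>s msym_aug N \<nu> :: 'a symfun)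
           = of_nat (m * fact n * (\<Prod>j=1..k. fact (count_list \<nu> j))
                       * fact (N - (\<Sum>j=1..k. count_list \<nu> j))) \<cdot>\<^sub>s msym \<nu>"
proof
  show "(hchrom_symfun (complete_multipartite \<nu>) H :: 'a symfun)
      = of_nat (m * fact n) \<cdot>\<^sub>s msym_aug N \<nu>"
    unfolding assms(7) by (rule hchrom_symfun_complete_multipartite[OF assms(1-6)])
  \<comment> \<open>All parts lie in \<open>{1..k}\<close>, so the multiplicities add up to the
    number of parts.\<close>
  have sum: "(\<Sum>j=1..k. count_list \<nu> j) = n"
    using sum_count_set[OF set_partition_subset[OF assms(2)]] assms(3) by simp
  show "(of_nat (m * fact n) \<cdot>\<^sub>s msym_aug N \<nu> :: 'a symfun)
           = of_nat (m * fact n * (\<Prod>j=1..k. fact (count_list \<nu> j))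
                       * fact (N - (\<Sum>j=1..k. count_list \<nu> j))) \<cdot>\<^sub>s msym \<nu>"
  proof (cases "n \<le> N")
    case True
    then show ?thesis
      using assms(2,3) unfolding sum by (simp add: msym_aug_def is_partition_def mult.assoc)
  next
    case False
    \<comment> \<open>Here \<open>msym_aug\<close> is 0 by convention, but on the right
      \<open>N - n\<close> truncates to 0 and its factorial is 1. Both sides agree because
      \<open>m = 0\<close>: a clique with \<open>n\<close> vertices does not fit into
      \<open>H\<close>.\<close>
    have "n \<ge> 1" using assms(1-3) by (cases \<nu>) (auto simp: is_partition_def)
    moreover have "cliques n H = {}"
    proof -
      have "card S \<le> N" if "S \<subseteq> pverts H" for S
        using card_mono[OF _ that] assms(4,5) by (simp add: simple_graph_iff)
      then show ?thesis using False by (auto simp: cliques_def)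
    qed
    ultimately have "m = 0"
      using bij_betw_same_card[OF copies_complete_graph[OF assms(4)]] assms(7) by simp
    then show ?thesis by simp
  qed
qed

end
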